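(* There exists a universal constant $C>0$ such that the following holds. Let $\mathcal{K}$ be the Koopman operator of a measure-preserving dynamical system on $L^2(\Omega,\omega)$, let $V_N$ be the span of a dictionary $\psi_1,\dots,\psi_N$, and let $\mathbb{K}$ be the mpEDMD matrices computed from $M$ snapshots (see context). Let $L\in\mathbb{N}$ and let $g\in L^2(\Omega,\omega)$ with $\|g\|=1$. If $\{g,\mathcal{K}g,\ldots,\mathcal{K}^{L}g\}\subset V_N$, $g=\Psi\pmb{g}$ with $\pmb{g}\in\mathbb{C}^N$, and the quadrature converges, i.e. $\lim_{M\to\infty}G_{jk}=\langle\psi_k,\psi_j\rangle$ and $\lim_{M\to\infty}A_{jk}=\langle\mathcal{K}\psi_k,\psi_j\rangle$ for $1\le j,k\le N$, then $$ \lim_{M\rightarrow\infty}W_1\left(\mu_g,\mu_{\pmb{g}}^{(N,M)}\right)\leq C\,\frac{\log(L)}{L}, $$ where, in forming $\mu_{\pmb{g}}^{(N,M)}$, the coefficient vector $\pmb{g}$ is normalized so that $\pmb{g}^*G\pmb{g}=1$ (i.e. replaced by $\pmb{g}/(\pmb{g}^*G\pmb{g})^{1/2}$ for each $M$).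
   Context: Setting. $\Omega\subseteq\mathbb{R}^d$, $\omega$ is a positive measure on $\Omega$, and $F:\Omega\to\Omega$ is measurable and preserves $\omega$. The Koopman operator $\mathcal{K}g=g\circ F$ is an isometry on $L^2(\Omega,\omega)$, whose inner product (linear in the first argument) and norm are $\langle\cdot,\cdot\rangle$ and $\|\cdot\|$. $\mathbb{T}$ is the unit circle in $\mathbb{C}$. Spectral measures of $\mathcal{K}$. There is a unitary operator $\mathcal{K}'$ on a Hilbert space $\mathcal{H}'\supseteq L^2(\Omega,\omega)$ (closed subspace) with $\mathcal{K}'|_{L^2(\Omega,\omega)}=\mathcal{K}$. Let $\mathcal{E}'$ be the projection-valued spectral measure of $\mathcal{K}'$ on $\mathbb{T}$ and $\mathcal{P}:\mathcal{H}'\to L^2(\Omega,\omega)$ the orthogonal projection. The spectral measure of $\mathcal{K}$ is $\mathcal{E}(U)=\mathcal{P}\mathcal{E}'(U)\mathcal{P}^*$, $U\subset\mathbb{T}$ Borel; it does not depend on the choice of unitary extension. For $g\in L^2(\Omega,\omega)$ with $\|g\|=1$, $\mu_g$ is the Borel probability measure on $\mathbb{T}$ given by $\mu_g(U)=\langle\mathcal{E}(U)g,g\rangle$. mpEDMD. The dictionary $\psi_1,\dots,\psi_N\in L^2(\Omega,\omega)$ is linearly independent with span $V_N$. Write $\Psi(\pmb{x})=[\psi_1(\pmb{x})\ \cdots\ \psi_N(\pmb{x})]$, and for $\pmb{c}\in\mathbb{C}^N$, $\Psi\pmb{c}=\sum_j c_j\psi_j\in V_N$. For each $M$ the data are points $\pmb{x}^{(m)}\in\Omega$,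 $\pmb{y}^{(m)}=F(\pmb{x}^{(m)})$, $m=1,\dots,M$, with quadrature weights $w_m\ge 0$ (points and weights may depend on $M$); $W=\mathrm{diag}(w_1,\dots,w_M)$. $\Psi_X,\Psi_Y\in\mathbb{C}^{M\times N}$ are the matrices whose $m$th rows are $\Psi(\pmb{x}^{(m)})$ and $\Psi(\pmb{y}^{(m)})$. Put $G=\Psi_X^*W\Psi_X$ and $A=\Psi_X^*W\Psi_Y$ (both depend on $M$); $G$ is assumed invertible. Take any singular value decomposition $G^{-1/2}A^*G^{-1/2}=U_1\Sigma U_2^*$ with $U_1,U_2$ unitary, and set $\mathbb{K}=G^{-1/2}U_2U_1^*G^{1/2}$. Take an eigendecomposition $U_2U_1^*=\hat V\Lambda\hat V^*$ with $\hat V$ unitary and $\Lambda=\mathrm{diag}(\lambda_1,\dots,\lambda_N)$, and let $v_j$ be the $j$th column of $V=G^{-1/2}\hat V$, so that $\mathbb{K}v_j=\lambda_jv_j$. For $\pmb{g}\in\mathbb{C}^N$ with $\pmb{g}^*G\pmb{g}=1$, $\mu_{\pmb{g}}^{(N,M)}$ is the probability measure on $\mathbb{T}$ given by $\mu_{\pmb{g}}^{(N,M)}(U)=\sum_{\lambda_j\in U}|v_j^*G\pmb{g}|^2$. Wasserstein distance. For Borel probability measures $\mu,\nu$ on $\mathbb{T}$, $W_1(\mu,\nu)=\sup\{\int_{\mathbb{T}}\phi\,d(\mu-\nu):\phi:\mathbb{T}\to\mathbb{R}\text{ Lipschitz with constant}\le1\}$, the Lipschitz constant being with respect to $|\lam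bda-\lambda'|$.
   Formalization: Stated for L ≥ 2 (for L = 1 the bound is 0 and fails, e.g. z→z², g = z, V = span{z, z²}; for L = 0 it is undefined); the limit is read as a limsup since it need not exist; G is invertible for all large M; H' has cardinality at most 2^(2^ℵ₀), which loses nothing. *)

theory Defs
  imports
    "HOL-Analysis.Analysis"
    "HOL-Library.Function_Algebras"
    "Jordan_Normal_Form.Schur_Decomposition"
begin

section \<open>Measure-preserving systems and the Koopman operator\<close>

text \<open>
  Points of \<open>d\<close>-dimensional Euclidean space are functions \<open>nat \<Rightarrow> real\<close> that are \<open>undefined\<close> outside
  \<open>{..<d}\<close>, so that \<open>d\<close> can be quantified inside a formula.  The set \<open>\<Omega>\<close> is \<open>space \<omega>\<close>; its
  sigma-algebra is arbitrary.
\<close>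

type_synonym point = "nat \<Rightarrow> real"
type_synonym observable = "point \<Rightarrow> complex"

definition measure_preserving_system :: "nat \<Rightarrow> point measure \<Rightarrow> (point \<Rightarrow> point) \<Rightarrow> bool" where
  "measure_preserving_system d \<omega> F \<longleftrightarrow>
     space \<omega> \<subseteq> ({..<d} \<rightarrow>\<^sub>E UNIV) \<and> F \<in> \<omega> \<rightarrow>\<^sub>M \<omega> \<and> distr \<omega> \<omega> F = \<omega>"

text \<open>
  Elements of the \<open>L2\<close> space are represented by functions.  Equality in \<open>L2\<close> is equality almost
  everywhere and is always written out as such.
\<close>

definition L2 :: "point measure \<Rightarrow> observable set" where
  "L2 \<omega> = {f. f \<in> borel_measurable \<omega> \<and> integrable \<omega> (\<lambda>z. (cmod (f z))\<^sup>2)}"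

definition l2_inner :: "point measure \<Rightarrow> observable \<Rightarrow> observable \<Rightarrow> complex" where
  "l2_inner \<omega> f g = (LINT z|\<omega>. f z * cnj (g z))"

definition koopman :: "(point \<Rightarrow> point) \<Rightarrow> observable \<Rightarrow> observable" where
  "koopman F g = g \<circ> F"

section \<open>Measures on the unit circle\<close>

definition circle_borel :: "complex measure" where
  "circle_borel = restrict_space borel (sphere 0 1)"

text \<open>
  The Borel measure on the circle with \<open>U \<mapsto> m U\<close>.  It is meant for countably additive \<open>m \<ge> 0\<close>;
  for other \<open>m\<close> it is the null measure.
\<close>

definition circle_measure :: "(complex set \<Rightarrow> real) \<Rightarrow> complex measure" where
  "circle_measure m = measure_of (sphere 0 1) (sets circle_borel) (\<lambda>U. ennreal (m U))"

definition W1 :: "complex measure \<Rightarrow> complex measure \<Rightarrow> ereal" where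
  "W1 \<mu> \<nu> = (SUP \<phi> \<in> {\<phi> :: complex \<Rightarrow> real. 1-lipschitz_on (sphere 0 1) \<phi>}.
      ereal ((LINT z|\<mu>. \<phi> z) - (LINT z|\<nu>. \<phi> z)))"

section \<open>Spectral measure of the Koopman operator\<close>

text \<open>
  A complex Hilbert space is carried by a linear subspace \<open>H\<close> of an arbitrary complex vector space.
  The inner product is only constrained on \<open>H\<close>.
\<close>

locale complex_hilbert_space = vector_space scale
  for scale :: "complex \<Rightarrow> 'h::ab_group_add \<Rightarrow> 'h" +
  fixes H :: "'h set" and ip :: "'h \<Rightarrow> 'h \<Rightarrow> complex"
  assumes subspace_H: "subspace H"
    and ip_add: "\<And>x y z. x \<in> H \<Longrightarrow> y \<in> H \<Longrightarrow> z \<in> H \<Longrightarrow> ip (x + y) z = ip x z + ip y z"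
    and ip_scale: "\<And>a x y. x \<in> H \<Longrightarrow> y \<in> H \<Longrightarrow> ip (scale a x) y = a * ip x y"
    and ip_cnj: "\<And>x y. x \<in> H \<Longrightarrow> y \<in> H \<Longrightarrow> ip y x = cnj (ip x y)"
    and ip_nonneg: "\<And>x. x \<in> H \<Longrightarrow> 0 \<le> Re (ip x x)"
    and ip_definite: "\<And>x. x \<in> H \<Longrightarrow> ip x x = 0 \<Longrightarrow> x = 0"
    and complete_H: "\<And>X :: nat \<Rightarrow> 'h.
      (\<forall>n. X n \<in> H) \<Longrightarrow>
      (\<forall>e>0. \<exists>k. \<forall>m\<ge>k. \<forall>n\<ge>k. sqrt (Re (ip (X m - X n) (X m - X n))) < e) \<Longrightarrow>
      \<exists>x\<in>H. (\<lambda>n. sqrt (Re (ip (X n - x) (X n - x)))) \<longlonglongrightarrow> 0"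
begin

definition hnorm :: "'h \<Rightarrow> real" where
  "hnorm x = sqrt (Re (ip x x))"

definition linear_op :: "('h \<Rightarrow> 'h) \<Rightarrow> bool" where
  "linear_op T \<longleftrightarrow> (\<forall>x\<in>H. T x \<in> H) \<and> (\<forall>x\<in>H. \<forall>y\<in>H. T (x + y) = T x + T y)
     \<and> (\<forall>a. \<forall>x\<in>H. T (scale a x) = scale a (T x))"

definition unitary_op :: "('h \<Rightarrow> 'h) \<Rightarrow> bool" where
  "unitary_op T \<longleftrightarrow> linear_op T \<and> T ` H = H \<and> (\<forall>x\<in>H. \<forall>y\<in>H. ip (T x) (T y) = ip x y)"

definition projection_op :: "('h \<Rightarrow> 'h) \<Rightarrow> bool" where
  "projection_op T \<longleftrightarrow> linear_op T \<and> (\<forall>x\<in>H. T (T x) = T x)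
     \<and> (\<forall>x\<in>H. \<forall>y\<in>H. ip (T x) y = ip x (T y))"

definition is_orthogonal_projection :: "'h set \<Rightarrow> 'h \<Rightarrow> 'h \<Rightarrow> bool" where
  "is_orthogonal_projection S x p \<longleftrightarrow> p \<in> S \<and> (\<forall>s\<in>S. ip (x - p) s = 0)"

definition projection_valued_measure :: "(complex set \<Rightarrow> 'h \<Rightarrow> 'h) \<Rightarrow> bool" where
  "projection_valued_measure E \<longleftrightarrow>
     (\<forall>U\<in>sets circle_borel. projection_op (E U))
   \<and> (\<forall>x\<in>H. E {} x = 0 \<and> E (sphere 0 1) x = x)
   \<and> (\<forall>U\<in>sets circle_borel. \<forall>V\<in>sets circle_borel. \<forall>x\<in>H. E (U \<inter> V) x = E U (E V x))
   \<and> (\<forall>U :: nat \<Rightarrow> complex set. range U \<subseteq> sets circle_borel \<longrightarrow> disjoint_family U \<longrightarrow>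
        (\<forall>x\<in>H. (\<lambda>n. hnorm ((\<Sum>i<n. E (U i) x) - E (\<Union>i. U i) x)) \<longlonglongrightarrow> 0))"

text \<open>
  \<open>T\<close> is the integral of the identity function with respect to \<open>E\<close>, in the weak sense; by
  polarization the diagonal case determines \<open>ip (T x) y\<close> for all \<open>x\<close> and \<open>y\<close>.
\<close>

definition spectral_measure_of :: "('h \<Rightarrow> 'h) \<Rightarrow> (complex set \<Rightarrow> 'h \<Rightarrow> 'h) \<Rightarrow> bool" where
  "spectral_measure_of T E \<longleftrightarrow> projection_valued_measure E \<and>
     (\<forall>x\<in>H. ip (T x) x = (LINT z|circle_measure (\<lambda>U. Re (ip (E U x) x)). z))"

end

text \<open>
  The inclusion of \<open>L2 \<omega>\<close> into the larger Hilbert space is a linear isometry \<open>J\<close>; being isometric,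
  it identifies exactly the functions that are equal almost everywhere, and its range is closed.
\<close>

locale koopman_unitary_extension = complex_hilbert_space scale H ip
  for scale :: "complex \<Rightarrow> 'h::ab_group_add \<Rightarrow> 'h" and H ip +
  fixes \<omega> :: "point measure" and F :: "point \<Rightarrow> point"
    and J :: "observable \<Rightarrow> 'h" and K' :: "'h \<Rightarrow> 'h" and E' :: "complex set \<Rightarrow> 'h \<Rightarrow> 'h"
  assumes J_in: "\<And>f. f \<in> L2 \<omega> \<Longrightarrow> J f \<in> H"
    and J_add: "\<And>f g. f \<in> L2 \<omega> \<Longrightarrow> g \<in> L2 \<omega> \<Longrightarrow> J (\<lambda>z. f z + g z) = J f + J g"
    and J_scale: "\<And>a f. f \<in> L2 \<omega> \<Longrightarrow> J (\<lambda>z. a * f z) = scale a (J f)"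
    and J_isometric: "\<And>f g. f \<in> L2 \<omega> \<Longrightarrow> g \<in> L2 \<omega> \<Longrightarrow> ip (J f) (J g) = l2_inner \<omega> f g"
    and unitary: "unitary_op K'"
    and extends: "\<And>f. f \<in> L2 \<omega> \<Longrightarrow> K' (J f) = J (koopman F f)"
    and spectral: "spectral_measure_of K' E'"
begin

text \<open>\<open>E U\<close> is the compression to \<open>L2 \<omega>\<close> of \<open>E' U\<close>; \<open>E U f\<close> is determined almost everywhere.\<close>

definition compression :: "(complex set \<Rightarrow> observable \<Rightarrow> observable) \<Rightarrow> bool" where
  "compression E \<longleftrightarrow> (\<forall>U\<in>sets circle_borel. \<forall>f\<in>L2 \<omega>.
     E U f \<in> L2 \<omega> \<and> is_orthogonal_projection (J ` L2 \<omega>) (E' U (J f)) (J (E U f)))"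

end

text \<open>
  The unitary extension is taken inside the type \<open>observable\<close> (with an arbitrary scalar
  multiplication), since the existential quantifier needs a fixed type.  This is no restriction: a
  minimal unitary extension has at most as many elements as this type, namely
  \<open>2 ^ (2 ^ aleph_0)\<close>, which is also the dimension of the complex vector space of all observables,
  so the extension can be embedded linearly.  The resulting \<open>E\<close> does not depend on the extension.
\<close>

definition koopman_spectral_measure ::
    "point measure \<Rightarrow> (point \<Rightarrow> point) \<Rightarrow> (complex set \<Rightarrow> observable \<Rightarrow> observable) \<Rightarrow> bool" where
  "koopman_spectral_measure \<omega> F E \<longleftrightarrow>
     (\<exists>(scale :: complex \<Rightarrow> observable \<Rightarrow> observable) H ip J K' E'.
        koopman_unitary_extension scale H ip \<omega> F J K' E' \<and>
        koopman_unitary_extension.compression ip \<omega> J E' E)"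

definition scalar_spectral_measure ::
    "point measure \<Rightarrow> (complex set \<Rightarrow> observable \<Rightarrow> observable) \<Rightarrow> observable \<Rightarrow> complex measure" where
  "scalar_spectral_measure \<omega> E g = circle_measure (\<lambda>U. Re (l2_inner \<omega> (E U g) g))"

section \<open>Dictionaries and mpEDMD\<close>

text \<open>Dictionary elements and snapshots are indexed from \<open>0\<close>.\<close>

definition synth :: "nat \<Rightarrow> (nat \<Rightarrow> observable) \<Rightarrow> complex vec \<Rightarrow> observable" where
  "synth N \<psi> c = (\<lambda>z. \<Sum>j<N. vec_index c j * \<psi> j z)"

definition dictionary :: "point measure \<Rightarrow> nat \<Rightarrow> (nat \<Rightarrow> observable) \<Rightarrow> bool" where
  "dictionary \<omega> N \<psi> \<longleftrightarrow> (\<forall>j<N. \<psi> j \<in> L2 \<omega>) \<and>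
     (\<forall>c\<in>carrier_vec N. (AE z in \<omega>. synth N \<psi> c z = 0) \<longrightarrow> c = 0\<^sub>v N)"

definition dict_span :: "point measure \<Rightarrow> nat \<Rightarrow> (nat \<Rightarrow> observable) \<Rightarrow> observable set" where
  "dict_span \<omega> N \<psi> = {f \<in> L2 \<omega>. \<exists>c\<in>carrier_vec N. AE z in \<omega>. f z = synth N \<psi> c z}"

definition psi_mat :: "nat \<Rightarrow> (nat \<Rightarrow> observable) \<Rightarrow> nat \<Rightarrow> (nat \<Rightarrow> point) \<Rightarrow> complex mat" where
  "psi_mat N \<psi> M x = Matrix.mat M N (\<lambda>(m, j). \<psi> j (x m))"

definition weight_mat :: "nat \<Rightarrow> (nat \<Rightarrow> real) \<Rightarrow> complex mat" where
  "weight_mat M w = mat_diag M (\<lambda>m. complex_of_real (w m))"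

definition G_mat ::
    "nat \<Rightarrow> (nat \<Rightarrow> observable) \<Rightarrow> nat \<Rightarrow> (nat \<Rightarrow> point) \<Rightarrow> (nat \<Rightarrow> real) \<Rightarrow> complex mat" where
  "G_mat N \<psi> M x w = mat_adjoint (psi_mat N \<psi> M x) * weight_mat M w * psi_mat N \<psi> M x"

definition A_mat ::
    "nat \<Rightarrow> (nat \<Rightarrow> observable) \<Rightarrow> (point \<Rightarrow> point) \<Rightarrow> nat \<Rightarrow> (nat \<Rightarrow> point) \<Rightarrow> (nat \<Rightarrow> real)
      \<Rightarrow> complex mat" where
  "A_mat N \<psi> F M x w =
     mat_adjoint (psi_mat N \<psi> M x) * weight_mat M w * psi_mat N \<psi> M (\<lambda>m. F (x m))"

definition unitary_mat :: "nat \<Rightarrow> complex mat \<Rightarrow> bool" where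
  "unitary_mat n U \<longleftrightarrow> U \<in> carrier_mat n n \<and> mat_adjoint U * U = 1\<^sub>m n \<and> U * mat_adjoint U = 1\<^sub>m n"

definition psd_sqrt_mat :: "nat \<Rightarrow> complex mat \<Rightarrow> complex mat \<Rightarrow> bool" where
  "psd_sqrt_mat n G R \<longleftrightarrow> R \<in> carrier_mat n n \<and> mat_adjoint R = R \<and>
     (\<forall>v\<in>carrier_vec n. 0 \<le> Re ((R *\<^sub>v v) \<bullet>c v)) \<and> R * R = G"

definition is_svd ::
    "nat \<Rightarrow> complex mat \<Rightarrow> complex mat \<Rightarrow> (nat \<Rightarrow> real) \<Rightarrow> complex mat \<Rightarrow> bool" where
  "is_svd n B U1 \<sigma> U2 \<longleftrightarrow> unitary_mat n U1 \<and> unitary_mat n U2 \<and> (\<forall>j<n. 0 \<le> \<sigma> j) \<and>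
     B = U1 * mat_diag n (\<lambda>j. complex_of_real (\<sigma> j)) * mat_adjoint U2"

text \<open>
  \<open>K\<close>, \<open>lam\<close>, \<open>V\<close> are a possible outcome of mpEDMD, for some choice of the singular value
  decomposition and of the eigendecomposition; \<open>R\<close> and \<open>S\<close> are the square root and the inverse
  square root of \<open>G\<close>.
\<close>

definition mpEDMD ::
    "nat \<Rightarrow> complex mat \<Rightarrow> complex mat \<Rightarrow> complex mat \<Rightarrow> (nat \<Rightarrow> complex) \<Rightarrow> complex mat \<Rightarrow> bool" where
  "mpEDMD N G A K lam V \<longleftrightarrow> invertible_mat G \<and>
     (\<exists>R S U1 \<sigma> U2 Vh.
        psd_sqrt_mat N G R \<and> S \<in> carrier_mat N N \<and> R * S = 1\<^sub>m N \<and> S * R = 1\<^sub>m N \<and>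
        is_svd N (S * mat_adjoint A * S) U1 \<sigma> U2 \<and>
        K = S * U2 * mat_adjoint U1 * R \<and>
        unitary_mat N Vh \<and> U2 * mat_adjoint U1 = Vh * mat_diag N lam * mat_adjoint Vh \<and>
        V = S * Vh)"

definition normalize_coeffs :: "complex mat \<Rightarrow> complex vec \<Rightarrow> complex vec" where
  "normalize_coeffs G c = complex_of_real (1 / sqrt (Re ((G *\<^sub>v c) \<bullet>c c))) \<cdot>\<^sub>v c"

definition mpEDMD_measure ::
    "nat \<Rightarrow> complex mat \<Rightarrow> (nat \<Rightarrow> complex) \<Rightarrow> complex mat \<Rightarrow> complex vec \<Rightarrow> complex measure" where
  "mpEDMD_measure N G lam V c =
     circle_measure (\<lambda>U. \<Sum>j | j < N \<and> lam j \<in> U. (cmod ((G *\<^sub>v c) \<bullet>c col V j))\<^sup>2)"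

end

theory Submission
  imports Defs "HOL-Probability.Probability_Measure"
begin

text \<open>
  The distance \<open>W1\<close> of two probability measures on the circle is controlled by the mixed moments
  \<open>\<integral> z\<^sup>i cnj z\<^sup>j\<close> with \<open>i, j \<le> L\<close>: averaging a Lipschitz function over the roots of unity of order
  \<open>n = L + 2\<close> against the kernel \<open>|p|\<^sup>2\<close>, where \<open>p\<close> has coefficients \<open>t (n - t)\<close>, is a trigonometric
  polynomial of degree \<open>L\<close>.  Multiplication by \<open>1 - w\<close> differences the coefficients of \<open>p\<close>, so the discrete
  Parseval identity and Cauchy-Schwarz bound the approximation error by \<open>sqrt 10 / n\<close>.

  The moments of \<open>\<mu>\<^sub>g\<close> are the inner products of \<open>K\<^sup>i g\<close> and \<open>K\<^sup>j g\<close>.  Those of the mpEDMD measure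
  converge to the same values: \<open>K\<close> is an isometry, so on the Krylov vectors the positive part \<open>P\<close> of
  the polar decomposition of EDMD satisfies \<open>(I - P\<^sup>2) u \<longlonglongrightarrow> 0\<close>, and
  \<open>(I - P) u\<close> is no longer than \<open>(I + P) (I - P) u\<close>.
  Hence the unitary part agrees in the limit with EDMD, which is exact on Krylov vectors.
\<close>

section \<open>A trigonometric kernel on roots of unity\<close>

text \<open>The limit of the EDMD matrix is the compression of the Koopman operator to the
  dictionary span. It may be singular, so its unitary factor need not be unique, the matrices
  \<open>K M\<close> need not converge, and singular vectors and eigenvectors are chosen afresh for
  every \<open>M\<close>. Hence no limit of \<open>lam\<close> or \<open>V\<close> is formed. For
  each \<open>M\<close> the eigencoordinates multiplied by powers of \<open>lam M\<close> are
  compared with those of the Krylov vectors, and the differences are measured in the norm given by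
  \<open>G M\<close>, which does not see the chosen basis.

  The smoothing kernel must be nonnegative with a small first moment. Equal coefficients (the Fejer
  kernel) would cost a logarithm; coefficients vanishing at both ends \<open>0\<close> and
  \<open>n\<close> avoid it. The rate is therefore 1 / L, and the logarithm in the theorem is slack.
  Averaging over \<open>n\<close> nodes instead of integrating loses nothing, because all degrees
  involved stay below \<open>n\<close>. Finitely many moments thus control \<open>W1\<close>
  uniformly over all Lipschitz functions, even if the measures themselves do not converge.\<close>

definition node :: "nat \<Rightarrow> nat \<Rightarrow> complex" where
  "node n k = cis (2 * pi * real k / real n)"

lemma norm_node [simp]: "cmod (node n k) = 1"
  by (simp add: node_def)

text \<open>A geometric sum whose ratio \<open>u\<close> is an \<open>n\<close>-th root of unity;
  \<open>u\<close> differs from 1 unless the exponents agree, as both lie below \<open>n\<close>.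
  The conjugate power stands in for a negative exponent.\<close>

lemma node_orthogonality:
  assumes "i < n" "j < n"
  shows "(\<Sum>k<n. cnj (node n k) ^ i * node n k ^ j) = (if i = j then of_nat n else 0)"
proof -
  define w where "w = cis (2 * pi / n)"
  have wk: "node n k = w ^ k" for k
    by (simp add: node_def w_def Complex.DeMoivre mult_ac)
  have unit: "cnj w * w = 1"
    by (simp add: w_def cis_cnj cis_mult)
  have wn: "w ^ n = 1"
    using assms by (simp add: w_def Complex.DeMoivre)
  define u where "u = cnj w ^ i * w ^ j"
  have sum: "(\<Sum>k<n. cnj (node n k) ^ i * node n k ^ j) = (\<Sum>k<n. u ^ k)"
    by (simp add: wk u_def power_mult_distrib flip: power_mult) (simp add: mult.commute)
  show ?thesis
  proof (cases "i = j")
    case True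
    then have "u = 1" using unit by (simp add: u_def flip: power_mult_distrib)
    then show ?thesis using True sum by simp
  next
    case False
    have "u \<noteq> 1"
    proof
      assume "u = 1"
      have "w ^ j = w ^ i * cnj w ^ i * w ^ j"
        using unit by (simp add: mult.commute flip: power_mult_distrib)
      also have "\<dots> = w ^ i" using \<open>u = 1\<close> by (simp add: u_def mult.assoc)
      finally have "node n i = node n j" by (simp add: wk)
      moreover have "inj_on (node n) {..<n}"
        using Complex.bij_betw_roots_unity[of n] assms by (simp add: bij_betw_def node_def[abs_def])
      ultimately show False using False assms by (auto dest: inj_onD)
    qed
    moreover have "u ^ n = 1"
    proof -
      have "u ^ n = cnj (w ^ n) ^ i * (w ^ n) ^ j"
        by (simp add: u_def power_mult_distrib flip: power_mult) (simp add: mult.commute)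
      then show ?thesis by (simp add: wn)
    qed
    ultimately show ?thesis using False sum by (simp add: geometric_sum)
  qed
qed

lemma cmod_sum_power_sq:
  fixes b :: "nat \<Rightarrow> complex"
  shows "complex_of_real ((cmod (\<Sum>j<n. b j * (z * cnj y) ^ j))\<^sup>2) =
    (\<Sum>i<n. \<Sum>j<n. b i * cnj (b j) * (z ^ i * cnj z ^ j) * (cnj y ^ i * y ^ j))"
  unfolding complex_norm_square cnj_sum sum_product
  by (intro sum.cong refl) (simp add: power_mult_distrib mult_ac)

text \<open>Degrees below \<open>n\<close> do not alias on \<open>n\<close> nodes, so only the
  diagonal of the expanded square survives. The result does not depend on \<open>z\<close>, which
  later makes the kernel weights sum to a constant.\<close>

lemma discrete_parseval:
  fixes b :: "nat \<Rightarrow> complex"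
  assumes "cmod z = 1"
  shows "(\<Sum>k<n. (cmod (\<Sum>j<n. b j * (z * cnj (node n k)) ^ j))\<^sup>2) = real n * (\<Sum>j<n. (cmod (b j))\<^sup>2)"
proof -
  have zz: "z ^ i * cnj z ^ i = 1" for i
    using assms complex_norm_square[of z] by (simp flip: power_mult_distrib)
  have "complex_of_real (\<Sum>k<n. (cmod (\<Sum>j<n. b j * (z * cnj (node n k)) ^ j))\<^sup>2) =
     (\<Sum>k<n. \<Sum>i<n. \<Sum>j<n. b i * cnj (b j) * (z ^ i * cnj z ^ j) * (cnj (node n k) ^ i * node n k ^ j))"
    unfolding of_real_sum cmod_sum_power_sq ..
  also have "\<dots> = (\<Sum>i<n. \<Sum>j<n. \<Sum>k<n. b i * cnj (b j) * (z ^ i * cnj z ^ j) * (cnj (node n k) ^ i * node n k ^ j))"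
    by (rule trans[OF sum.swap], rule sum.cong[OF refl], rule sum.swap)
  also have "\<dots> = (\<Sum>i<n. \<Sum>j<n. b i * cnj (b j) * (z ^ i * cnj z ^ j) * (if i = j then of_nat n else 0))"
    by (intro sum.cong refl) (simp add: node_orthogonality flip: sum_distrib_left)
  also have "\<dots> = (\<Sum>i<n. b i * cnj (b i) * of_nat n)"
    by (intro sum.cong refl) (simp add: zz if_distrib sum.If_cases mult.assoc cong: if_cong)
  also have "\<dots> = complex_of_real (real n * (\<Sum>j<n. (cmod (b j))\<^sup>2))"
    by (simp add: sum_distrib_left mult.commute flip: complex_norm_square)
  finally show ?thesis by (simp only: of_real_eq_iff)
qed

text \<open>Up to a constant, the error of the kernel is governed by the ratio of the squared
  differences to the squared coefficients. With zero ends the optimal choice is a sine sequence,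
  with ratio close to \<open>pi^2 / n^2\<close>; the parabola gives nearly the same,
  \<open>10 / n^2\<close>, and has sums in closed form.\<close>

definition parabola :: "nat \<Rightarrow> nat \<Rightarrow> real" where
  "parabola n t = real t * (real n - real t)"

definition kernel_poly :: "nat \<Rightarrow> complex \<Rightarrow> complex" where
  "kernel_poly n w = (\<Sum>j<n. of_real (parabola n (Suc j)) * w ^ j)"

definition kernel_mass :: "nat \<Rightarrow> real" where
  "kernel_mass n = (\<Sum>t<n. (parabola n (Suc t))\<^sup>2)"

lemma kernel_mass_eq: "kernel_mass n = real n * (real n ^ 4 - 1) / 30"
proof -
  \<comment> \<open>The upper limit \<open>k\<close> is separated from the parameter
    \<open>x\<close>: induction on \<open>n\<close> itself would change the summand.\<close>
  have "(\<Sum>t<k. (real (Suc t) * (x - real (Suc t)))\<^sup>2) =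
      x\<^sup>2 * (real k * (real k + 1) * (2 * real k + 1) / 6) - 2 * x * (real k * (real k + 1) / 2)\<^sup>2
      + real k * (real k + 1) * (2 * real k + 1) * (3 * real k ^ 2 + 3 * real k - 1) / 30" for x k
    by (induction k) (simp_all add: field_simps power2_eq_square power3_eq_cube power4_eq_xxxx)
  from this[of "real n" n] show ?thesis
    unfolding kernel_mass_def parabola_def
    by (simp add: field_simps power2_eq_square power3_eq_cube power4_eq_xxxx)
qed

lemma parabola_diff_sum: "(\<Sum>t<n. (parabola n t - parabola n (Suc t))\<^sup>2) = real n * ((real n)\<^sup>2 - 1) / 3"
proof -
  have "(\<Sum>t<k. (real t * (x - real t) - real (Suc t) * (x - real (Suc t)))\<^sup>2) =
      (x - 1)\<^sup>2 * real k - 2 * (x - 1) * (real k * (real k - 1))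
      + 4 * (real k * (real k - 1) * (2 * real k - 1) / 6)" for x k
    by (induction k) (simp_all add: field_simps power2_eq_square power3_eq_cube)
  from this[of "real n" n] show ?thesis
    unfolding parabola_def by (simp add: field_simps power2_eq_square power3_eq_cube)
qed

text \<open>Summation by parts; the boundary terms drop out because the parabola vanishes at
  \<open>0\<close> and at \<open>n\<close>.\<close>

lemma kernel_poly_times_diff:
  "(1 - w) * kernel_poly n w = - (\<Sum>j<n. of_real (parabola n j - parabola n (Suc j)) * w ^ j)"
proof -
  have "(1 - w) * (\<Sum>j<k. of_real (parabola n (Suc j)) * w ^ j) =
     - (\<Sum>j<k. of_real (parabola n j - parabola n (Suc j)) * w ^ j) - of_real (parabola n k) * w ^ k" for k
    by (induction k) (simp_all add: parabola_def[of n 0] algebra_simps)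
  from this[of n] show ?thesis by (simp add: kernel_poly_def parabola_def[of n n])
qed

lemma kernel_mass_pos: "n \<ge> 2 \<Longrightarrow> 0 < kernel_mass n"
proof -
  assume "n \<ge> 2"
  then have "1 < real n ^ 4" by (intro one_less_power) auto
  then show ?thesis using \<open>n \<ge> 2\<close> by (simp add: kernel_mass_eq)
qed

lemma kernel_total:
  assumes "cmod z = 1"
  shows "(\<Sum>k<n. (cmod (kernel_poly n (z * cnj (node n k))))\<^sup>2) = real n * kernel_mass n"
  unfolding kernel_poly_def kernel_mass_def
  by (subst discrete_parseval[OF assms]) simp

lemma kernel_first_moment:
  assumes z: "cmod z = 1" and n: "n \<ge> 2"
  shows "(\<Sum>k<n. cmod (node n k - z) * (cmod (kernel_poly n (z * cnj (node n k))))\<^sup>2)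
    \<le> sqrt 10 / real n * (real n * kernel_mass n)"
proof -
  define p where "p k = cmod (kernel_poly n (z * cnj (node n k)))" for k
  define d where "d k = cmod (node n k - z)" for k
  have dp: "(\<Sum>k<n. (d k * p k)\<^sup>2) = real n * (real n * ((real n)\<^sup>2 - 1) / 3)"
  proof -
    have "d k * p k = cmod (\<Sum>j<n. of_real (parabola n j - parabola n (Suc j)) * (z * cnj (node n k)) ^ j)" for k
    proof -
      have "node n k - z = node n k * (1 - z * cnj (node n k))"
        using complex_norm_square[of "node n k"] by (simp add: algebra_simps)
      then have "d k = cmod (1 - z * cnj (node n k))" by (simp add: d_def norm_mult)
      then have "d k * p k = cmod ((1 - z * cnj (node n k)) * kernel_poly n (z * cnj (node n k)))"
        by (simp add: p_def norm_mult)
      then show ?thesis unfolding kernel_poly_times_diff by (simp only: norm_minus_cancel)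
    qed
    then have "(\<Sum>k<n. (d k * p k)\<^sup>2) = real n * (\<Sum>j<n. (parabola n j - parabola n (Suc j))\<^sup>2)"
      using discrete_parseval[OF z, where n = n and b = "\<lambda>j. of_real (parabola n j - parabola n (Suc j))"]
      by (simp del: of_real_diff)
    then show ?thesis by (simp only: parabola_diff_sum)
  qed
  have pp: "(\<Sum>k<n. (p k)\<^sup>2) = real n * kernel_mass n"
    unfolding p_def by (rule kernel_total[OF z])
  have "(\<Sum>k<n. d k * (p k)\<^sup>2) = (\<Sum>k<n. \<bar>d k * p k\<bar> * \<bar>p k\<bar>)"
    by (simp add: d_def p_def power2_eq_square mult_ac)
  also have "\<dots> \<le> L2_set (\<lambda>k. d k * p k) {..<n} * L2_set p {..<n}"
    by (rule L2_set_mult_ineq)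
  also have "\<dots> = sqrt (real n * (real n * ((real n)\<^sup>2 - 1) / 3) * (real n * kernel_mass n))"
    by (simp only: L2_set_def dp pp real_sqrt_mult)
  \<comment> \<open>Origin of the 10: the quotient of \<open>n (n^2 - 1) / 3\<close> by
    \<open>n (n^4 - 1) / 30\<close> is \<open>10 / (n^2 + 1)\<close>, which is at most
    \<open>10 / n^2\<close>.\<close>
  also have "\<dots> \<le> sqrt ((sqrt 10 / real n * (real n * kernel_mass n))\<^sup>2)"
  proof (rule real_sqrt_le_mono)
    define r where "r = real n"
    have r: "r \<ge> 2" using n by (simp add: r_def)
    have km: "kernel_mass n = r * (r ^ 4 - 1) / 30" by (simp add: kernel_mass_eq r_def)
    have "r * (r * (r\<^sup>2 - 1) / 3) * (r * kernel_mass n) = kernel_mass n * (r ^ 3 * (r\<^sup>2 - 1) / 3)"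
      by (simp add: power3_eq_cube)
    also have "\<dots> \<le> kernel_mass n * (10 * kernel_mass n)"
    proof (rule mult_left_mono)
      have "r ^ 3 * (r\<^sup>2 - 1) \<le> r * (r ^ 4 - 1)"
        using r mult_mono[of 1 r 1 r] by (simp add: algebra_simps eval_nat_numeral)
      then show "r ^ 3 * (r\<^sup>2 - 1) / 3 \<le> 10 * kernel_mass n" by (simp add: km)
      show "0 \<le> kernel_mass n" using kernel_mass_pos[OF n] by simp
    qed
    also have "\<dots> = (sqrt 10 / r * (r * kernel_mass n))\<^sup>2"
      using r by (simp add: power_mult_distrib power2_eq_square)
    finally show "real n * (real n * ((real n)\<^sup>2 - 1) / 3) * (real n * kernel_mass n)
       \<le> (sqrt 10 / real n * (real n * kernel_mass n))\<^sup>2"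
      by (simp add: r_def)
  qed
  also have "\<dots> = sqrt 10 / real n * (real n * kernel_mass n)"
    using kernel_mass_pos[OF n] by simp
  finally show ?thesis by (simp add: d_def p_def)
qed

text \<open>The normalized weights are nonnegative and sum to one, so the smoothed value is an
  average of \<open>f\<close> over the nodes, and the Lipschitz bound turns the error into the first
  moment of the kernel.\<close>

lemma kernel_approx:
  fixes f :: "complex \<Rightarrow> real"
  assumes z: "cmod z = 1" and n: "n \<ge> 2" and f: "1-lipschitz_on (sphere 0 1) f"
  shows "\<bar>f z - (\<Sum>k<n. f (node n k) * (cmod (kernel_poly n (z * cnj (node n k))))\<^sup>2) / (real n * kernel_mass n)\<bar>
    \<le> sqrt 10 / real n"
proof -
  define p where "p k = (cmod (kernel_poly n (z * cnj (node n k))))\<^sup>2" for k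
  define Z where "Z = real n * kernel_mass n"
  have Z: "Z > 0" using kernel_mass_pos[OF n] n by (simp add: Z_def)
  have total: "(\<Sum>k<n. p k) = Z" unfolding p_def Z_def by (rule kernel_total[OF z])
  have "f z - (\<Sum>k<n. f (node n k) * p k) / Z = (\<Sum>k<n. (f z - f (node n k)) * p k) / Z"
    using Z by (simp add: left_diff_distrib sum_subtractf total diff_divide_distrib flip: sum_distrib_left)
  also have "\<bar>\<dots>\<bar> \<le> (\<Sum>k<n. \<bar>(f z - f (node n k)) * p k\<bar>) / Z"
    using Z by (simp add: divide_right_mono)
  also have "\<dots> \<le> (\<Sum>k<n. cmod (node n k - z) * p k) / Z"
  proof (intro divide_right_mono sum_mono)
    fix k
    have "\<bar>f z - f (node n k)\<bar> \<le> cmod (node n k - z)"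
      using lipschitz_onD[OF f, of z "node n k"] z by (simp add: dist_norm norm_minus_commute)
    then show "\<bar>(f z - f (node n k)) * p k\<bar> \<le> cmod (node n k - z) * p k"
      by (simp add: abs_mult p_def mult_right_mono)
  qed (use Z in simp)
  also have "\<dots> \<le> (sqrt 10 / real n * Z) / Z"
    using kernel_first_moment[OF z n] Z unfolding p_def Z_def by (intro divide_right_mono) auto
  also have "\<dots> = sqrt 10 / real n" using Z by simp
  finally show ?thesis by (simp add: p_def Z_def)
qed

section \<open>Wasserstein distance and moments\<close>

text \<open>The last coefficient, at index \<open>n - 1\<close>, is \<open>parabola n n = 0\<close>.
  Hence \<open>n = L + 2\<close> nodes give degree \<open>L\<close>, and only moments with indices
  up to \<open>L\<close> occur.\<close>

lemma kernel_poly_Suc_Suc: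
  "kernel_poly (Suc (Suc L)) w = (\<Sum>j<Suc L. of_real (parabola (Suc (Suc L)) (Suc j)) * w ^ j)"
  unfolding kernel_poly_def by (subst sum.lessThan_Suc) (simp add: parabola_def)

text \<open>On the circle this is the Fourier coefficient of index \<open>i - j\<close>. Two indices
  match the inner product of the \<open>i\<close>-th and \<open>j\<close>-th iterates and avoid
  negative powers.\<close>

definition moment :: "complex measure \<Rightarrow> nat \<Rightarrow> nat \<Rightarrow> complex" where
  "moment \<mu> i j = (LINT z|\<mu>. z ^ i * cnj z ^ j)"

locale circle_prob = prob_space \<mu> for \<mu> :: "complex measure" +
  assumes sets_circle: "sets \<mu> = sets circle_borel"
begin

lemma space_circle: "space \<mu> = sphere 0 1"
  using sets_eq_imp_space_eq[OF sets_circle] by (simp add: circle_borel_def space_restrict_space)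

lemma integrable_continuous:
  fixes f :: "complex \<Rightarrow> 'b::{banach, second_countable_topology}"
  assumes "continuous_on (sphere 0 1) f"
  shows "integrable \<mu> f"
proof -
  have "compact (f ` sphere 0 1)"
    by (intro compact_continuous_image assms compact_sphere)
  then obtain B where B: "\<And>z. z \<in> sphere 0 1 \<Longrightarrow> norm (f z) \<le> B"
    by (meson bounded_iff compact_imp_bounded image_eqI)
  have "f \<in> borel_measurable \<mu>"
    using borel_measurable_continuous_on_restrict[OF assms]
    by (subst measurable_cong_sets[OF sets_circle refl]) (simp add: circle_borel_def)
  then show ?thesis
    by (rule integrable_const_bound[of _ B, rotated]) (auto simp: space_circle B)
qed

lemma integral_kernel:
  "complex_of_real (LINT z|\<mu>. (cmod (kernel_poly (Suc (Suc L)) (z * cnj y)))\<^sup>2) =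
    (\<Sum>i<Suc L. \<Sum>j<Suc L. of_real (parabola (Suc (Suc L)) (Suc i)) * of_real (parabola (Suc (Suc L)) (Suc j))
       * (cnj y ^ i * y ^ j) * moment \<mu> i j)"
proof -
  have *: "complex_of_real ((cmod (kernel_poly (Suc (Suc L)) (z * cnj y)))\<^sup>2) =
    (\<Sum>i<Suc L. \<Sum>j<Suc L. of_real (parabola (Suc (Suc L)) (Suc i)) * of_real (parabola (Suc (Suc L)) (Suc j))
       * (cnj y ^ i * y ^ j) * (z ^ i * cnj z ^ j))" for z
    unfolding kernel_poly_Suc_Suc cmod_sum_power_sq by (intro sum.cong refl) (simp add: mult_ac)
  have int: "integrable \<mu> (\<lambda>z. a * (z ^ i * cnj z ^ j))" for i j and a :: complex
    by (intro integrable_continuous continuous_intros)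
  show ?thesis
    unfolding integral_complex_of_real[symmetric] * moment_def
    by (simp only: Bochner_Integration.integral_sum Bochner_Integration.integrable_sum int
         integral_mult_right_zero)
qed

end

text \<open>Replacing the test function by its smoothed version costs \<open>sqrt 10 / n\<close>
  once for each measure. What remains is integrated exactly by moments; the coefficients in front of
  the moment differences depend on \<open>L\<close> only, which is enough once these differences
  tend to zero.\<close>

lemma W1_le_moments:
  assumes "circle_prob \<mu>" "circle_prob \<nu>"
  shows "W1 \<mu> \<nu> \<le> ereal (2 * sqrt 10 / real (L + 2) +
    (\<Sum>i<Suc L. \<Sum>j<Suc L. 2 / kernel_mass (L + 2) * \<bar>parabola (L + 2) (Suc i) * parabola (L + 2) (Suc j)\<bar>
       * cmod (moment \<mu> i j - moment \<nu> i j)))"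
  unfolding W1_def
proof (intro SUP_least, simp only: mem_Collect_eq ereal_less_eq)
  interpret \<mu>: circle_prob \<mu> by fact
  interpret \<nu>: circle_prob \<nu> by fact
  fix f :: "complex \<Rightarrow> real" assume f: "1-lipschitz_on (sphere 0 1) f"
  define n where "n = Suc (Suc L)"
  define a where "a j = parabola n (Suc j)" for j
  define s where "s = kernel_mass n"
  have n: "n \<ge> 2" by (simp add: n_def)
  have s: "s > 0" using kernel_mass_pos[OF n] by (simp add: s_def)
  \<comment> \<open>Both measures have mass one, so a constant cancels in the difference. After the
    shift the values at the nodes are bounded by the diameter 2, uniformly in
    \<open>f\<close>.\<close>
  define g where "g z = f z - f 1" for z
  have g: "1-lipschitz_on (sphere 0 1) g"
    using f by (simp add: lipschitz_on_def g_def dist_norm)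
  have g_cont: "continuous_on (sphere 0 1) g" using g by (rule lipschitz_on_continuous_on)
  have f_cont: "continuous_on (sphere 0 1) f" using f by (rule lipschitz_on_continuous_on)
  have g_le: "\<bar>g (node n k)\<bar> \<le> 2" for k
  proof -
    have "\<bar>g (node n k)\<bar> \<le> cmod (node n k - 1)"
      using lipschitz_onD[OF f, of "node n k" 1] by (simp add: dist_norm g_def)
    also have "\<dots> \<le> 2" using norm_triangle_ineq4[of "node n k" 1] by simp
    finally show ?thesis .
  qed
  define p where "p k z = (cmod (kernel_poly n (z * cnj (node n k))))\<^sup>2" for k z
  have p_cont: "continuous_on S (p k)" for S k
    unfolding p_def kernel_poly_def by (intro continuous_intros)
  define q where "q z = (\<Sum>k<n. g (node n k) * p k z) / (real n * s)" for z
  have q_cont: "continuous_on S q" for S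
    unfolding q_def by (intro continuous_intros p_cont) (use n s in auto)
  have approx: "\<bar>(LINT z|\<eta>. g z) - (LINT z|\<eta>. q z)\<bar> \<le> sqrt 10 / real n" if "circle_prob \<eta>" for \<eta>
  proof -
    interpret circle_prob \<eta> by fact
    have "\<bar>(LINT z|\<eta>. g z) - (LINT z|\<eta>. q z)\<bar> = \<bar>LINT z|\<eta>. g z - q z\<bar>"
      by (subst Bochner_Integration.integral_diff) (auto intro!: integrable_continuous g_cont q_cont)
    also have "\<dots> \<le> (LINT z|\<eta>. \<bar>g z - q z\<bar>)" by (rule integral_abs_bound)
    also have "\<dots> \<le> (LINT z|\<eta>. sqrt 10 / real n)"
      using kernel_approx[OF _ n g]
      by (intro integral_mono integrable_continuous continuous_intros g_cont q_cont)
        (auto simp: space_circle q_def p_def s_def)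
    finally show ?thesis by (simp add: prob_space)
  qed
  define D where "D = (\<Sum>i<Suc L. \<Sum>j<Suc L. \<bar>a i * a j\<bar> * cmod (moment \<mu> i j - moment \<nu> i j))"
  have "\<bar>(LINT z|\<mu>. p k z) - (LINT z|\<nu>. p k z)\<bar> \<le> D" for k
  proof -
    have "\<bar>(LINT z|\<mu>. p k z) - (LINT z|\<nu>. p k z)\<bar> = cmod (of_real (LINT z|\<mu>. p k z) - of_real (LINT z|\<nu>. p k z))"
      by (simp flip: of_real_diff)
    also have "\<dots> = cmod (\<Sum>i<Suc L. \<Sum>j<Suc L. of_real (a i) * of_real (a j) * (cnj (node n k) ^ i * node n k ^ j)
         * (moment \<mu> i j - moment \<nu> i j))"
      unfolding p_def n_def \<mu>.integral_kernel \<nu>.integral_kernel a_def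
      by (simp only: sum_subtractf right_diff_distrib)
    also have "\<dots> \<le> D" unfolding D_def
      by (intro sum_norm_le) (simp add: norm_mult norm_power abs_mult)
    finally show ?thesis .
  qed
  note pk = this
  have "\<bar>(LINT z|\<mu>. q z) - (LINT z|\<nu>. q z)\<bar> =
     \<bar>\<Sum>k<n. g (node n k) * ((LINT z|\<mu>. p k z) - (LINT z|\<nu>. p k z))\<bar> / (real n * s)"
    unfolding q_def using s
    by (simp add: \<mu>.integrable_continuous \<nu>.integrable_continuous p_cont right_diff_distrib sum_subtractf
         abs_div_pos flip: diff_divide_distrib)
  also have "\<dots> \<le> (\<Sum>k<n. 2 * D) / (real n * s)"
  proof (intro divide_right_mono)
    show "\<bar>\<Sum>k<n. g (node n k) * ((LINT z|\<mu>. p k z) - (LINT z|\<nu>. p k z))\<bar> \<le> (\<Sum>k<n. 2 * D)"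
      by (rule order_trans[OF sum_abs], intro sum_mono) (simp add: abs_mult mult_mono g_le pk)
  qed (use s in simp)
  also have "\<dots> = 2 / s * D" using n by simp
  finally have q_diff: "\<bar>(LINT z|\<mu>. q z) - (LINT z|\<nu>. q z)\<bar> \<le> 2 / s * D" .
  have shift: "(LINT z|\<eta>. f z) = (LINT z|\<eta>. g z) + f 1" if "circle_prob \<eta>" for \<eta>
  proof -
    interpret circle_prob \<eta> by fact
    show ?thesis unfolding g_def
      by (subst Bochner_Integration.integral_diff) (auto simp: prob_space intro!: integrable_continuous f_cont)
  qed
  have "(LINT z|\<mu>. f z) - (LINT z|\<nu>. f z) \<le> 2 * sqrt 10 / real n + 2 / s * D"
    using approx[OF assms(1)] approx[OF assms(2)] q_diff unfolding shift[OF assms(1)] shift[OF assms(2)]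
    by linarith
  then show "(LINT z|\<mu>. f z) - (LINT z|\<nu>. f z) \<le> 2 * sqrt 10 / real (L + 2) +
    (\<Sum>i<Suc L. \<Sum>j<Suc L. 2 / kernel_mass (L + 2) * \<bar>parabola (L + 2) (Suc i) * parabola (L + 2) (Suc j)\<bar>
       * cmod (moment \<mu> i j - moment \<nu> i j))"
    by (simp add: D_def n_def s_def a_def sum_distrib_left mult.assoc del: sum.lessThan_Suc)
qed

section \<open>Measures on the circle built from set functions\<close>

lemma space_circle_borel [simp]: "space circle_borel = sphere 0 1"
  by (simp add: circle_borel_def space_restrict_space)

lemma sets_circle_measure [simp]: "sets (circle_measure m) = sets circle_borel"
  unfolding circle_measure_def using sets.sets_measure_of_eq[of circle_borel] by simp

lemma space_circle_measure [simp]: "space (circle_measure m) = sphere 0 1"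
  using sets_eq_imp_space_eq[OF sets_circle_measure] by simp

lemma circle_measure_cong:
  assumes "\<And>U. U \<in> sets circle_borel \<Longrightarrow> m U = m' U"
  shows "circle_measure m = circle_measure m'"
  unfolding circle_measure_def
  using sets.sigma_sets_eq[of circle_borel] sets.space_closed[of circle_borel]
  by (intro measure_of_eq) (auto simp: assms)

lemma emeasure_circle_measure:
  assumes "\<And>U. U \<in> sets circle_borel \<Longrightarrow> 0 \<le> m U" "m {} = 0"
    and "\<And>U :: nat \<Rightarrow> complex set. range U \<subseteq> sets circle_borel \<Longrightarrow> disjoint_family U \<Longrightarrow>
      (\<lambda>i. m (U i)) sums m (\<Union>i. U i)"
    and "U \<in> sets circle_borel"
  shows "emeasure (circle_measure m) U = ennreal (m U)"
  unfolding circle_measure_def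
proof (rule emeasure_measure_of_sigma)
  show "sigma_algebra (sphere 0 1) (sets circle_borel)"
    using sets.sigma_algebra_axioms[of circle_borel] by simp
  show "positive (sets circle_borel) (\<lambda>U. ennreal (m U))" by (simp add: positive_def assms)
  show "countably_additive (sets circle_borel) (\<lambda>U. ennreal (m U))"
    by (intro countably_additiveI suminf_ennreal_eq assms) auto
qed fact

lemma circle_measure_eqI:
  assumes D: "sets D = sets circle_borel"
    and em: "\<And>U. U \<in> sets circle_borel \<Longrightarrow> emeasure D U = ennreal (m U)"
  shows "circle_measure m = D"
proof -
  have "space D = sphere 0 1" using sets_eq_imp_space_eq[OF D] by simp
  then have "D = measure_of (sphere 0 1) (sets circle_borel) (emeasure D)"
    using measure_of_of_measure[of D] D by simp
  also have "\<dots> = circle_measure m"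
    unfolding circle_measure_def
    using sets.sigma_sets_eq[of circle_borel] sets.space_closed[of circle_borel]
    by (intro measure_of_eq) (auto simp: em)
  finally show ?thesis ..
qed

text \<open>The measure is the image under \<open>lam\<close> of a weighted point measure on the
  indices. Coinciding eigenvalues then need no separate treatment, and integrals become finite sums
  over indices.\<close>

lemma atomic_circle_measure:
  fixes lam :: "nat \<Rightarrow> complex" and p :: "nat \<Rightarrow> real"
  assumes lam: "\<And>j. j < N \<Longrightarrow> cmod (lam j) = 1" and p: "\<And>j. 0 \<le> p j"
  defines "\<mu> \<equiv> circle_measure (\<lambda>U. \<Sum>j | j < N \<and> lam j \<in> U. p j)"
  shows moment_atomic: "moment \<mu> i j = (\<Sum>k<N. of_real (p k) * (lam k ^ i * cnj (lam k) ^ j))"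
    and circle_prob_atomic: "(\<Sum>k<N. p k) = 1 \<Longrightarrow> circle_prob \<mu>"
proof -
  define D where "D = distr (point_measure {..<N} p) circle_borel lam"
  have lam_meas: "lam \<in> point_measure {..<N} p \<rightarrow>\<^sub>M circle_borel"
    using lam by (auto simp: space_point_measure)
  have em: "emeasure D U = ennreal (\<Sum>j | j < N \<and> lam j \<in> U. p j)" if U: "U \<in> sets circle_borel" for U
  proof -
    have "lam -` U \<inter> {..<N} = {j. j < N \<and> lam j \<in> U}" by auto
    then have "emeasure D U = emeasure (point_measure {..<N} p) {j. j < N \<and> lam j \<in> U}"
      by (simp add: D_def emeasure_distr[OF lam_meas U] space_point_measure)
    also have "\<dots> = (\<Sum>j | j < N \<and> lam j \<in> U. ennreal (p j))"
      by (rule emeasure_point_measure_finite) auto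
    finally show ?thesis by (simp add: p sum_ennreal)
  qed
  have \<mu>: "\<mu> = D" unfolding \<mu>_def by (rule circle_measure_eqI) (simp_all add: em, simp add: D_def)
  have "(\<lambda>z. z ^ i * cnj z ^ j) \<in> borel_measurable circle_borel"
    unfolding circle_borel_def by (intro borel_measurable_continuous_on_restrict continuous_intros)
  then show "moment \<mu> i j = (\<Sum>k<N. of_real (p k) * (lam k ^ i * cnj (lam k) ^ j))"
    unfolding moment_def \<mu> D_def
    by (subst integral_distr[OF lam_meas]) (simp_all add: lebesgue_integral_point_measure_finite p scaleR_conv_of_real)
  assume one: "(\<Sum>k<N. p k) = 1"
  have sp: "space D = sphere 0 1" by (simp add: D_def)
  have "{j. j < N \<and> lam j \<in> sphere 0 1} = {..<N}" using lam by auto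
  then have "emeasure \<mu> (space \<mu>) = 1"
    using em[of "sphere 0 1"] sets.top[of circle_borel] one unfolding \<mu> sp by simp
  then have "prob_space \<mu>" by (rule prob_spaceI)
  then show "circle_prob \<mu>" by (simp add: circle_prob_def circle_prob_axioms_def \<mu>_def)
qed

section \<open>Moments of the spectral measure of a unitary operator\<close>

context complex_hilbert_space
begin

lemma H_zero [simp]: "0 \<in> H" and H_add: "x \<in> H \<Longrightarrow> y \<in> H \<Longrightarrow> x + y \<in> H"
  and H_scale: "x \<in> H \<Longrightarrow> scale a x \<in> H" and H_diff: "x \<in> H \<Longrightarrow> y \<in> H \<Longrightarrow> x - y \<in> H"
  and H_sum: "(\<And>i. i \<in> I \<Longrightarrow> f i \<in> H) \<Longrightarrow> sum f I \<in> H"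
  using subspace_H by (auto intro: subspace_0 subspace_add subspace_scale subspace_diff subspace_sum)

lemma ip_scale_right: "x \<in> H \<Longrightarrow> y \<in> H \<Longrightarrow> ip x (scale a y) = cnj a * ip x y"
  using ip_cnj[of "scale a y" x] ip_cnj[of y x] by (simp add: H_scale ip_scale)

lemma ip_add_right: "x \<in> H \<Longrightarrow> y \<in> H \<Longrightarrow> z \<in> H \<Longrightarrow> ip x (y + z) = ip x y + ip x z"
  using ip_cnj[of "y + z" x] ip_cnj[of y x] ip_cnj[of z x] by (simp add: H_add ip_add)

lemma ip_zero [simp]: "y \<in> H \<Longrightarrow> ip 0 y = 0" "y \<in> H \<Longrightarrow> ip y 0 = 0"
  using ip_scale[of y y 0] ip_scale_right[of y y 0] by simp_all

lemma ip_diff: "x \<in> H \<Longrightarrow> y \<in> H \<Longrightarrow> z \<in> H \<Longrightarrow> ip (x - y) z = ip x z - ip y z"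
  using ip_add[of "x - y" y z] by (simp add: H_diff)

lemma ip_diff_right: "x \<in> H \<Longrightarrow> y \<in> H \<Longrightarrow> z \<in> H \<Longrightarrow> ip x (y - z) = ip x y - ip x z"
  using ip_add_right[of x "y - z" z] by (simp add: H_diff)

lemma ip_sum: "(\<And>i. i \<in> I \<Longrightarrow> f i \<in> H) \<Longrightarrow> y \<in> H \<Longrightarrow> ip (sum f I) y = (\<Sum>i\<in>I. ip (f i) y)"
  by (induction I rule: infinite_finite_induct) (auto simp: ip_add H_sum)

lemma ip_sum_right: "(\<And>i. i \<in> I \<Longrightarrow> f i \<in> H) \<Longrightarrow> y \<in> H \<Longrightarrow> ip y (sum f I) = (\<Sum>i\<in>I. ip y (f i))"
  by (induction I rule: infinite_finite_induct) (auto simp: ip_add_right H_sum)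

lemma ip_self: "x \<in> H \<Longrightarrow> ip x x = of_real ((hnorm x)\<^sup>2)"
proof -
  assume x: "x \<in> H"
  have "Im (ip x x) = 0" using ip_cnj[OF x x] by (metis cnj.simps(2) neg_equal_zero)
  then show ?thesis using ip_nonneg[OF x] by (simp add: hnorm_def complex_eq_iff)
qed

lemma hnorm_nonneg [simp]: "x \<in> H \<Longrightarrow> 0 \<le> hnorm x"
  by (simp add: hnorm_def ip_nonneg)

lemma cauchy_schwarz:
  assumes x: "x \<in> H" and y: "y \<in> H"
  shows "cmod (ip x y) \<le> hnorm x * hnorm y"
proof -
  define t where "t = ip x y"
  define X where "X = (hnorm x)\<^sup>2"
  define Y where "Y = (hnorm y)\<^sup>2"
  have yx: "ip y x = cnj t" using ip_cnj[OF x y] by (simp add: t_def)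
  \<comment> \<open>The part of \<open>x\<close> orthogonal to \<open>y\<close>, multiplied by
    \<open>Y\<close> to avoid a division; \<open>Y = 0\<close> is settled apart by
    definiteness.\<close>
  define u where "u = scale (of_real Y) x - scale t y"
  have "0 \<le> Re (ip u u)" by (intro ip_nonneg) (simp add: u_def x y H_diff H_scale)
  also have "ip u u = of_real Y * (of_real Y * of_real X) - cnj t * t * of_real Y"
    unfolding u_def using x y
    by (simp add: ip_diff ip_diff_right ip_scale ip_scale_right H_diff H_scale yx
        ip_self[OF x, folded X_def] ip_self[OF y, folded Y_def] algebra_simps flip: t_def)
  also have "Re \<dots> = Y * (Y * X - (cmod t)\<^sup>2)"
    by (simp add: complex_mult_cnj cmod_power2[of t] algebra_simps)
  finally have pos: "0 \<le> Y * (Y * X - (cmod t)\<^sup>2)" .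
  show ?thesis
  proof (cases "Y = 0")
    case True
    then have "y = 0" using ip_definite[OF y] ip_self[OF y] by (simp add: Y_def)
    then show ?thesis using x by (simp add: hnorm_def)
  next
    case False
    then have "Y > 0" by (simp add: Y_def)
    with pos have "(cmod t)\<^sup>2 \<le> (hnorm x * hnorm y)\<^sup>2"
      by (simp add: zero_le_mult_iff X_def Y_def power_mult_distrib mult.commute)
    then show ?thesis unfolding t_def by (rule power2_le_imp_le) (simp add: x y)
  qed
qed

lemma hnorm_zero [simp]: "hnorm 0 = 0"
  by (simp add: hnorm_def)

lemma hnorm_add_sq: "x \<in> H \<Longrightarrow> y \<in> H \<Longrightarrow> (hnorm (x + y))\<^sup>2 = (hnorm x)\<^sup>2 + 2 * Re (ip x y) + (hnorm y)\<^sup>2"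
proof -
  assume x: "x \<in> H" and y: "y \<in> H"
  have "complex_of_real ((hnorm (x + y))\<^sup>2) = of_real ((hnorm x)\<^sup>2) + (ip x y + cnj (ip x y)) + of_real ((hnorm y)\<^sup>2)"
    unfolding ip_self[OF H_add[OF x y], symmetric] ip_self[OF x, symmetric] ip_self[OF y, symmetric]
    using ip_cnj[OF x y] x y by (simp add: ip_add ip_add_right H_add)
  then show ?thesis unfolding complex_add_cnj by (simp only: of_real_eq_iff flip: of_real_add)
qed

lemma hnorm_triangle: "x \<in> H \<Longrightarrow> y \<in> H \<Longrightarrow> hnorm (x + y) \<le> hnorm x + hnorm y"
proof -
  assume x: "x \<in> H" and y: "y \<in> H"
  have "Re (ip x y) \<le> hnorm x * hnorm y"
    using cauchy_schwarz[OF x y] complex_Re_le_cmod[of "ip x y"] by linarith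
  then have "(hnorm (x + y))\<^sup>2 \<le> (hnorm x + hnorm y)\<^sup>2"
    by (simp add: hnorm_add_sq[OF x y] power2_sum)
  then show ?thesis by (rule power2_le_imp_le) (simp add: x y)
qed

lemma hnorm_scale: "x \<in> H \<Longrightarrow> hnorm (scale a x) = cmod a * hnorm x"
proof -
  assume x: "x \<in> H"
  have "complex_of_real ((hnorm (scale a x))\<^sup>2) = of_real ((cmod a * hnorm x)\<^sup>2)"
    unfolding ip_self[OF H_scale[OF x], symmetric] power_mult_distrib of_real_mult complex_norm_square
      ip_self[OF x, symmetric]
    using x by (simp add: ip_scale ip_scale_right H_scale)
  then have "(hnorm (scale a x))\<^sup>2 = (cmod a * hnorm x)\<^sup>2" by (simp only: of_real_eq_iff)
  then show ?thesis by (rule power2_eq_imp_eq) (simp_all add: x H_scale)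
qed

lemma hnorm_minus_commute: "x \<in> H \<Longrightarrow> y \<in> H \<Longrightarrow> hnorm (x - y) = hnorm (y - x)"
  unfolding hnorm_def by (simp add: ip_diff ip_diff_right H_diff)

lemma tendsto_ip:
  fixes X Y :: "nat \<Rightarrow> 'h"
  assumes X: "\<And>n. X n \<in> H" "x \<in> H" "(\<lambda>n. hnorm (X n - x)) \<longlonglongrightarrow> 0"
    and Y: "\<And>n. Y n \<in> H" "y \<in> H" "(\<lambda>n. hnorm (Y n - y)) \<longlonglongrightarrow> 0"
  shows "(\<lambda>n. ip (X n) (Y n)) \<longlonglongrightarrow> ip x y"
proof (rule Lim_transform2[OF tendsto_const])
  have "(\<lambda>n. hnorm (X n - x) * hnorm (Y n - y) + hnorm x * hnorm (Y n - y) + hnorm (X n - x) * hnorm y)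
      \<longlonglongrightarrow> 0 * 0 + hnorm x * 0 + 0 * hnorm y"
    by (intro tendsto_intros X Y)
  then have lim: "(\<lambda>n. hnorm (X n - x) * hnorm (Y n - y) + hnorm x * hnorm (Y n - y) + hnorm (X n - x) * hnorm y) \<longlonglongrightarrow> 0"
    by simp
  show "(\<lambda>n. ip x y - ip (X n) (Y n)) \<longlonglongrightarrow> 0"
  proof (rule Lim_null_comparison[OF always_eventually lim], rule allI)
    fix n
    have "ip (X n) (Y n) - ip x y = ip (X n - x) (Y n - y) + ip x (Y n - y) + ip (X n - x) y"
      by (simp add: ip_diff ip_diff_right H_diff X Y)
    then have "norm (ip x y - ip (X n) (Y n)) = norm (ip (X n - x) (Y n - y) + ip x (Y n - y) + ip (X n - x) y)"
      by (metis norm_minus_commute)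
    also have "\<dots> \<le> norm (ip (X n - x) (Y n - y)) + norm (ip x (Y n - y)) + norm (ip (X n - x) y)"
      by (rule order_trans[OF norm_triangle_ineq add_right_mono[OF norm_triangle_ineq]])
    also have "\<dots> \<le> hnorm (X n - x) * hnorm (Y n - y) + hnorm x * hnorm (Y n - y) + hnorm (X n - x) * hnorm y"
      by (intro add_mono cauchy_schwarz H_diff X Y)
    finally show "norm (ip x y - ip (X n) (Y n)) \<le>
       hnorm (X n - x) * hnorm (Y n - y) + hnorm x * hnorm (Y n - y) + hnorm (X n - x) * hnorm y" .
  qed
qed

text \<open>Polarization with the four scalars 1, -1, \<i>, -\<i>; in the sum of the four squared
  norms the cross terms cancel. The factor 2 is the usual one between numerical radius and operator
  norm, since \<open>D\<close> need not be self-adjoint.\<close>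

lemma quadratic_form_bound:
  assumes D: "linear_op D" and q: "\<And>x. x \<in> H \<Longrightarrow> cmod (ip (D x) x) \<le> \<epsilon> * (hnorm x)\<^sup>2"
    and x: "x \<in> H" and \<epsilon>: "0 \<le> \<epsilon>"
  shows "hnorm (D x) \<le> 2 * \<epsilon> * hnorm x"
proof -
  have D_in: "\<And>x. x \<in> H \<Longrightarrow> D x \<in> H" and D_add: "\<And>x y. x \<in> H \<Longrightarrow> y \<in> H \<Longrightarrow> D (x + y) = D x + D y"
    and D_scale: "\<And>a x. x \<in> H \<Longrightarrow> D (scale a x) = scale a (D x)"
    using D by (auto simp: linear_op_def)
  have polar: "2 * cmod (ip (D x) y) \<le> \<epsilon> * (2 * ((hnorm x)\<^sup>2 + (hnorm y)\<^sup>2))" if y: "y \<in> H" for y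
  proof -
    define Q where "Q a = ip (D (x + scale a y)) (x + scale a y)" for a
    have Q: "Q a = ip (D x) x + a * ip (D y) x + cnj a * ip (D x) y + a * cnj a * ip (D y) y" for a
      unfolding Q_def using x y
      by (simp add: D_add D_scale D_in H_add H_scale ip_add ip_add_right ip_scale ip_scale_right algebra_simps)
    have N: "(hnorm (x + scale a y))\<^sup>2 = (hnorm x)\<^sup>2 + 2 * Re (cnj a * ip x y) + (cmod a)\<^sup>2 * (hnorm y)\<^sup>2" for a
      using x y by (simp add: hnorm_add_sq H_scale ip_scale_right hnorm_scale power_mult_distrib)
    have "4 * ip (D x) y = (Q 1 - Q (-1)) + \<i> * (Q \<i> - Q (- \<i>))"
      unfolding Q by (simp add: algebra_simps)
    also have "cmod \<dots> \<le> cmod (Q 1) + cmod (Q (-1)) + (cmod (Q \<i>) + cmod (Q (-\<i>)))"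
      by (intro order_trans[OF norm_triangle_ineq] add_mono norm_triangle_ineq4)
        (simp add: norm_mult norm_triangle_ineq4)
    also have "\<dots> \<le> \<epsilon> * (hnorm (x + scale 1 y))\<^sup>2 + \<epsilon> * (hnorm (x + scale (-1) y))\<^sup>2
       + (\<epsilon> * (hnorm (x + scale \<i> y))\<^sup>2 + \<epsilon> * (hnorm (x + scale (-\<i>) y))\<^sup>2)"
      unfolding Q_def by (intro add_mono q H_add H_scale x y)
    also have "\<dots> = \<epsilon> * (4 * ((hnorm x)\<^sup>2 + (hnorm y)\<^sup>2))"
      unfolding N by (simp add: algebra_simps)
    finally show ?thesis by (simp add: norm_mult algebra_simps)
  qed
  show ?thesis
  proof (cases "hnorm (D x) = 0")
    case True then show ?thesis using \<epsilon> x by simp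
  next
    case False
    \<comment> \<open>The test vector is \<open>D x\<close> rescaled to the length of
      \<open>x\<close>, which balances the two squared norms in \<open>polar\<close>.\<close>
    define t where "t = hnorm x / hnorm (D x)"
    have pos: "hnorm (D x) > 0" using False hnorm_nonneg[OF D_in[OF x]] by simp
    have t: "t \<ge> 0" using x pos by (simp add: t_def)
    have "2 * cmod (ip (D x) (scale (of_real t) (D x))) \<le> \<epsilon> * (2 * ((hnorm x)\<^sup>2 + (hnorm (scale (of_real t) (D x)))\<^sup>2))"
      by (intro polar H_scale D_in x)
    also have "hnorm (scale (of_real t) (D x)) = hnorm x"
      using pos t x by (simp add: hnorm_scale D_in t_def norm_divide)
    also have "cmod (ip (D x) (scale (of_real t) (D x))) = hnorm x * hnorm (D x)"
      using pos t x by (simp add: ip_scale_right D_in ip_self norm_mult norm_power norm_divide t_def power2_eq_square)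
    finally have "hnorm x * hnorm (D x) \<le> hnorm x * (2 * \<epsilon> * hnorm x)"
      by (simp add: power2_eq_square algebra_simps)
    moreover have "hnorm x > 0"
    proof (rule ccontr)
      assume "\<not> 0 < hnorm x"
      then have "hnorm x = 0" using hnorm_nonneg[OF x] by simp
      then have "x = 0" using ip_definite[OF x] ip_self[OF x] by simp
      then have "D x = 0" using D_scale[OF x, of 0] by simp
      then show False using False by simp
    qed
    ultimately show ?thesis by simp
  qed
qed

end

text \<open>Rounding to a square grid of mesh \<open>1 / k\<close> gives a function with finitely
  many values on the circle, so spectral integrals become finite sums. Division by zero makes
  \<open>k = 0\<close> collapse to the origin; limits therefore run along
  \<open>Suc k\<close>.\<close>

definition grid_round :: "nat \<Rightarrow> complex \<Rightarrow> complex" where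
  "grid_round k z = Complex (\<lfloor>real k * Re z\<rfloor> / real k) (\<lfloor>real k * Im z\<rfloor> / real k)"

lemma grid_round_approx:
  assumes "k > 0"
  shows "cmod (z - grid_round k z) \<le> 2 / real k"
proof -
  have *: "\<bar>t - \<lfloor>real k * t\<rfloor> / real k\<bar> \<le> 1 / real k" for t :: real
  proof -
    have "t - \<lfloor>real k * t\<rfloor> / real k = (real k * t - \<lfloor>real k * t\<rfloor>) / real k"
      using assms by (simp add: field_simps)
    moreover have "\<bar>real k * t - \<lfloor>real k * t\<rfloor>\<bar> \<le> 1" by linarith
    ultimately show ?thesis using assms by (simp add: divide_right_mono)
  qed
  have "cmod (z - grid_round k z) \<le> \<bar>Re (z - grid_round k z)\<bar> + \<bar>Im (z - grid_round k z)\<bar>"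
    by (rule cmod_le)
  also have "\<dots> \<le> 1 / real k + 1 / real k" 
    unfolding grid_round_def by (intro add_mono) (simp_all add: *)
  finally show ?thesis by simp
qed

text \<open>Modulus one plus the rounding error, at worst 2 for the coarsest grid: a bound uniform
  in \<open>k\<close>, as dominated convergence requires.\<close>

lemma grid_round_bound: "z \<in> sphere 0 1 \<Longrightarrow> cmod (grid_round (Suc k) z) \<le> 3"
proof -
  assume z: "z \<in> sphere 0 1"
  have "cmod (grid_round (Suc k) z) \<le> cmod z + cmod (z - grid_round (Suc k) z)"
    using norm_triangle_ineq4[of z "z - grid_round (Suc k) z"] by simp
  also have "\<dots> \<le> 1 + 2 / real (Suc k)" using z grid_round_approx[of "Suc k" z] by simp
  also have "\<dots> \<le> 3" by (simp add: field_simps)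
  finally show ?thesis .
qed

lemma tendsto_grid_round: "(\<lambda>k. grid_round (Suc k) z) \<longlonglongrightarrow> z"
proof (rule Lim_transform2[OF tendsto_const])
  have lim: "(\<lambda>k. 2 / real (Suc k)) \<longlonglongrightarrow> 0"
    by (intro LIMSEQ_Suc lim_const_over_n)
  show "(\<lambda>k. z - grid_round (Suc k) z) \<longlonglongrightarrow> 0"
    by (rule Lim_null_comparison[OF always_eventually lim], rule allI, rule grid_round_approx) simp
qed

lemma finite_grid_round: "finite (grid_round k ` sphere 0 1)"
proof (rule finite_subset)
  let ?I = "{- int k..int k}"
  show "grid_round k ` sphere 0 1 \<subseteq> (\<lambda>(a, b). Complex (of_int a / real k) (of_int b / real k)) ` (?I \<times> ?I)"
  proof
    fix v assume "v \<in> grid_round k ` sphere 0 1"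
    then obtain z where z: "cmod z = 1" and v: "v = grid_round k z" by auto
    have I: "\<lfloor>real k * t\<rfloor> \<in> ?I" if "\<bar>t\<bar> \<le> 1" for t :: real
    proof -
      have "\<bar>real k * t\<bar> \<le> real k" using that by (simp add: abs_mult mult_left_le)
      then show ?thesis by (simp add: floor_le_iff le_floor_iff) linarith
    qed
    have "\<lfloor>real k * Re z\<rfloor> \<in> ?I" "\<lfloor>real k * Im z\<rfloor> \<in> ?I"
      using abs_Re_le_cmod[of z] abs_Im_le_cmod[of z] z by (auto intro!: I simp del: atLeastAtMost_iff)
    then show "v \<in> (\<lambda>(a, b). Complex (of_int a / real k) (of_int b / real k)) ` (?I \<times> ?I)"
      unfolding v grid_round_def by (intro image_eqI[of _ _ "(\<lfloor>real k * Re z\<rfloor>, \<lfloor>real k * Im z\<rfloor>)"]) auto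
  qed
qed auto

lemma grid_round_measurable: "grid_round k \<in> borel_measurable borel"
proof -
  have floor: "(\<lambda>z. \<lfloor>real k * f z\<rfloor> / real k) \<in> borel_measurable borel"
    if "f \<in> borel_measurable borel" for f :: "complex \<Rightarrow> real"
    by (intro borel_measurable_divide borel_measurable_const
        measurable_compose[OF _ borel_measurable_real_floor] borel_measurable_times that)
  show ?thesis
    unfolding borel_measurable_complex_iff grid_round_def complex.sel
    by (intro conjI floor borel_measurable_Re borel_measurable_Im)
qed

definition grid_cell :: "nat \<Rightarrow> complex \<Rightarrow> complex set" where
  "grid_cell k v = {z \<in> sphere 0 1. grid_round k z = v}"

lemma grid_cell_sets [simp]: "grid_cell k v \<in> sets circle_borel"
proof -
  have "grid_cell k v = (grid_round k -` {v} \<inter> space borel) \<inter> sphere 0 1" by (auto simp: grid_cell_def)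
  moreover have "grid_round k -` {v} \<inter> space borel \<in> sets borel"
    by (rule measurable_sets[OF grid_round_measurable]) simp
  ultimately show ?thesis by (auto simp: circle_borel_def sets_restrict_space)
qed

lemma grid_cell_Int: "v \<noteq> w \<Longrightarrow> grid_cell k v \<inter> grid_cell k w = {}"
  by (auto simp: grid_cell_def)

section \<open>Spectral sums over grid cells and their limit\<close>

context complex_hilbert_space
begin

context
  fixes E assumes pvm: "projection_valued_measure E"
begin

lemma pvm_in: "U \<in> sets circle_borel \<Longrightarrow> x \<in> H \<Longrightarrow> E U x \<in> H"
  and pvm_add: "U \<in> sets circle_borel \<Longrightarrow> x \<in> H \<Longrightarrow> y \<in> H \<Longrightarrow> E U (x + y) = E U x + E U y"
  and pvm_scale: "U \<in> sets circle_borel \<Longrightarrow> x \<in> H \<Longrightarrow> E U (scale a x) = scale a (E U x)"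
  and pvm_adjoint: "U \<in> sets circle_borel \<Longrightarrow> x \<in> H \<Longrightarrow> y \<in> H \<Longrightarrow> ip (E U x) y = ip x (E U y)"
  and pvm_idem: "U \<in> sets circle_borel \<Longrightarrow> x \<in> H \<Longrightarrow> E U (E U x) = E U x"
  and pvm_Int: "U \<in> sets circle_borel \<Longrightarrow> V \<in> sets circle_borel \<Longrightarrow> x \<in> H \<Longrightarrow> E U (E V x) = E (U \<inter> V) x"
  and pvm_empty: "x \<in> H \<Longrightarrow> E {} x = 0"
  and pvm_total: "x \<in> H \<Longrightarrow> E (sphere 0 1) x = x"
  using pvm unfolding projection_valued_measure_def projection_op_def linear_op_def by simp_all

lemma pvm_sum:
  assumes "U \<in> sets circle_borel" "\<And>i. i \<in> I \<Longrightarrow> f i \<in> H"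
  shows "E U (sum f I) = (\<Sum>i\<in>I. E U (f i))"
  using assms(2)
  by (induction I rule: infinite_finite_induct)
    (use pvm_scale[OF assms(1) H_zero, of 0] in \<open>auto simp: pvm_add[OF assms(1)] H_sum\<close>)

definition quad_measure :: "'h \<Rightarrow> complex measure" where
  "quad_measure x = circle_measure (\<lambda>U. Re (ip (E U x) x))"

lemma quad_nonneg: "U \<in> sets circle_borel \<Longrightarrow> x \<in> H \<Longrightarrow> ip (E U x) x = of_real ((hnorm (E U x))\<^sup>2)"
  using pvm_adjoint[of U "E U x" x] by (simp add: pvm_in pvm_idem ip_self del: of_real_power)

lemma emeasure_quad_measure:
  assumes x: "x \<in> H" and U: "U \<in> sets circle_borel"
  shows "emeasure (quad_measure x) U = ennreal (Re (ip (E U x) x))"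
  unfolding quad_measure_def
proof (rule emeasure_circle_measure)
  fix U :: "nat \<Rightarrow> complex set" assume U: "range U \<subseteq> sets circle_borel" "disjoint_family U"
  then have Ui: "U i \<in> sets circle_borel" for i by auto
  have "(\<lambda>n. hnorm ((\<Sum>i<n. E (U i) x) - E (\<Union>i. U i) x)) \<longlonglongrightarrow> 0"
    using pvm U x unfolding projection_valued_measure_def by blast
  then have "(\<lambda>n. ip (\<Sum>i<n. E (U i) x) x) \<longlonglongrightarrow> ip (E (\<Union>i. U i) x) x"
    by (intro tendsto_ip H_sum pvm_in Ui x sets.countable_UN) (use U x in auto)
  then have "(\<lambda>n. Re (ip (\<Sum>i<n. E (U i) x) x)) \<longlonglongrightarrow> Re (ip (E (\<Union>i. U i) x) x)"
    by (rule tendsto_Re)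
  then show "(\<lambda>i. Re (ip (E (U i) x) x)) sums Re (ip (E (\<Union>i. U i) x) x)"
    by (simp add: sums_def ip_sum pvm_in Ui x)
qed (use x U in \<open>auto simp: quad_nonneg pvm_empty\<close>)

lemma finite_quad_measure: "x \<in> H \<Longrightarrow> finite_measure (quad_measure x)"
  using emeasure_quad_measure[of x "sphere 0 1"] sets.top[of circle_borel]
  by (intro finite_measureI) (simp add: quad_measure_def)

lemma measure_quad_measure:
  "x \<in> H \<Longrightarrow> U \<in> sets circle_borel \<Longrightarrow> measure (quad_measure x) U = Re (ip (E U x) x)"
  by (simp add: measure_def emeasure_quad_measure quad_nonneg)

lemma circle_prob_quad_measure:
  assumes "x \<in> H" "hnorm x = 1"
  shows "circle_prob (quad_measure x)"
proof -
  have "prob_space (quad_measure x)"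
    using emeasure_quad_measure[of x "sphere 0 1"] sets.top[of circle_borel] assms
    by (intro prob_spaceI) (simp add: quad_measure_def pvm_total ip_self)
  then show ?thesis by (simp add: circle_prob_def circle_prob_axioms_def quad_measure_def)
qed

text \<open>The integral of the simple function \<open>grid_round k z ^ i\<close> with respect to
  the projection-valued measure; it plays the role of the \<open>i\<close>-th power of the operator
  on a grid.\<close>

definition grid_power :: "nat \<Rightarrow> nat \<Rightarrow> 'h \<Rightarrow> 'h" where
  "grid_power k i x = (\<Sum>v\<in>grid_round k ` sphere 0 1. scale (v ^ i) (E (grid_cell k v) x))"

lemma grid_power_in: "x \<in> H \<Longrightarrow> grid_power k i x \<in> H"
  unfolding grid_power_def by (intro H_sum H_scale pvm_in) auto

lemma linear_op_grid_power: "linear_op (grid_power k i)"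
  unfolding linear_op_def
proof (intro conjI ballI allI)
  fix x y a assume x: "x \<in> H" 
  show "grid_power k i x \<in> H" by (simp add: grid_power_in x)
  show "grid_power k i (scale a x) = scale a (grid_power k i x)"
    unfolding grid_power_def by (simp add: pvm_scale x scale_sum_right mult.commute)
  assume y: "y \<in> H"
  show "grid_power k i (x + y) = grid_power k i x + grid_power k i y"
    unfolding grid_power_def by (simp add: pvm_add x y scale_right_distrib sum.distrib)
qed

lemma grid_cell_pvm:
  "x \<in> H \<Longrightarrow> E (grid_cell k v) (E (grid_cell k w) x) = (if v = w then E (grid_cell k v) x else 0)"
  by (simp add: pvm_Int grid_cell_Int pvm_empty)

text \<open>Projections of disjoint cells annihilate each other, so these sums multiply like the
  simple functions they integrate. The multiplicativity of \<open>E\<close> on intersections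
  provides this; the weak representation of \<open>T\<close> speaks only of quadratic forms.\<close>

lemma grid_power_comp:
  assumes x: "x \<in> H"
  shows "grid_power k i (grid_power k j x) = grid_power k (i + j) x"
proof -
  have "E (grid_cell k v) (grid_power k j x) = scale (v ^ j) (E (grid_cell k v) x)"
    if "v \<in> grid_round k ` sphere 0 1" for v
  proof -
    have "E (grid_cell k v) (grid_power k j x) =
      (\<Sum>w\<in>grid_round k ` sphere 0 1. if v = w then scale (v ^ j) (E (grid_cell k v) x) else 0)"
      unfolding grid_power_def
      by (subst pvm_sum) (auto simp: pvm_in H_scale x pvm_scale grid_cell_pvm intro!: sum.cong)
    then show ?thesis using that by (simp add: finite_grid_round)
  qed
  then show ?thesis
    unfolding grid_power_def[of k i] grid_power_def[of k "i + j"] by (simp add: power_add)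
qed

lemma integral_grid_round:
  fixes h :: "complex \<Rightarrow> complex"
  assumes x: "x \<in> H"
  shows "(LINT z|quad_measure x. h (grid_round k z)) =
     (\<Sum>v\<in>grid_round k ` sphere 0 1. h v * ip (E (grid_cell k v) x) x)"
proof -
  interpret finite_measure "quad_measure x" by (rule finite_quad_measure[OF x])
  have [simp]: "grid_cell k v \<in> sets (quad_measure x)" for v by (simp add: quad_measure_def)
  have "(LINT z|quad_measure x. h (grid_round k z)) =
     (LINT z|quad_measure x. (\<Sum>v\<in>grid_round k ` sphere 0 1. h v * of_real (indicator (grid_cell k v) z)))"
  proof (rule Bochner_Integration.integral_cong[OF refl])
    fix z assume "z \<in> space (quad_measure x)"
    then have z: "z \<in> sphere 0 1" by (simp add: quad_measure_def)
    have "(\<Sum>v\<in>grid_round k ` sphere 0 1. h v * of_real (indicator (grid_cell k v) z)) =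
        (\<Sum>v\<in>grid_round k ` sphere 0 1. if grid_round k z = v then h v else 0)"
      using z by (intro sum.cong) (auto simp: grid_cell_def)
    then show "h (grid_round k z) = (\<Sum>v\<in>grid_round k ` sphere 0 1. h v * of_real (indicator (grid_cell k v) z))"
      using z by (simp add: finite_grid_round)
  qed
  also have "\<dots> = (\<Sum>v\<in>grid_round k ` sphere 0 1. h v * of_real (measure (quad_measure x) (grid_cell k v)))"
    by (simp add: emeasure_eq_measure)
  also have "\<dots> = (\<Sum>v\<in>grid_round k ` sphere 0 1. h v * ip (E (grid_cell k v) x) x)"
    by (simp add: measure_quad_measure x quad_nonneg)
  finally show ?thesis .
qed

text \<open>Distinct cells have orthogonal ranges, so only diagonal terms remain. The moment
  identity thus holds exactly on every grid, and a limit can be taken on each side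
  separately.\<close>

lemma ip_grid_power:
  assumes x: "x \<in> H"
  shows "ip (grid_power k i x) (grid_power k j x) =
    (LINT z|quad_measure x. grid_round k z ^ i * cnj (grid_round k z) ^ j)"
proof -
  have "ip (grid_power k i x) (grid_power k j x) =
    (\<Sum>v\<in>grid_round k ` sphere 0 1. \<Sum>w\<in>grid_round k ` sphere 0 1.
      v ^ i * (cnj w ^ j * ip (E (grid_cell k v) x) (E (grid_cell k w) x)))"
    unfolding grid_power_def
    by (simp add: ip_sum ip_sum_right ip_scale ip_scale_right pvm_in x H_scale H_sum mult.left_commute,
        simp add: sum_distrib_left mult_ac, rule sum.swap)
  also have "\<dots> = (\<Sum>v\<in>grid_round k ` sphere 0 1. \<Sum>w\<in>grid_round k ` sphere 0 1.
      if v = w then (v ^ i * cnj v ^ j) * ip (E (grid_cell k v) x) x else 0)"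
  proof (intro sum.cong refl)
    fix v w
    have "ip (E (grid_cell k v) x) (E (grid_cell k w) x) = ip (E (grid_cell k w) (E (grid_cell k v) x)) x"
      by (simp add: pvm_adjoint pvm_in x)
    then show "v ^ i * (cnj w ^ j * ip (E (grid_cell k v) x) (E (grid_cell k w) x)) =
        (if v = w then (v ^ i * cnj v ^ j) * ip (E (grid_cell k v) x) x else 0)"
      by (simp add: grid_cell_pvm x)
  qed
  also have "\<dots> = (LINT z|quad_measure x. grid_round k z ^ i * cnj (grid_round k z) ^ j)"
    unfolding integral_grid_round[OF x, where h = "\<lambda>z. z ^ i * cnj z ^ j"]
    by (simp add: finite_grid_round)
  finally show ?thesis .
qed

lemma quad_measure_measurable [measurable_cong]: "sets (quad_measure x) = sets (restrict_space borel (sphere 0 1))"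
  by (simp add: quad_measure_def circle_borel_def)

lemma measurable_quad_measure: "f \<in> borel_measurable borel \<Longrightarrow> f \<in> borel_measurable (quad_measure x)"
  by (subst measurable_cong_sets[OF quad_measure_measurable refl]) (rule measurable_restrict_space1)

lemma tendsto_integral_grid_round:
  assumes x: "x \<in> H"
  shows "(\<lambda>k. LINT z|quad_measure x. grid_round (Suc k) z ^ i * cnj (grid_round (Suc k) z) ^ j)
    \<longlonglongrightarrow> moment (quad_measure x) i j"
  unfolding moment_def
proof (rule integral_dominated_convergence[where w = "\<lambda>_. 3 ^ i * 3 ^ j"])
  interpret finite_measure "quad_measure x" by (rule finite_quad_measure[OF x])
  show "integrable (quad_measure x) (\<lambda>_. 3 ^ i * 3 ^ j :: real)" by simp
  show "AE z in quad_measure x. (\<lambda>k. grid_round (Suc k) z ^ i * cnj (grid_round (Suc k) z) ^ j) \<longlonglongrightarrow> z ^ i * cnj z ^ j"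
    by (intro AE_I2 tendsto_intros tendsto_grid_round)
  show "AE z in quad_measure x. norm (grid_round (Suc k) z ^ i * cnj (grid_round (Suc k) z) ^ j) \<le> 3 ^ i * 3 ^ j" for k
    unfolding norm_mult norm_power complex_mod_cnj
    by (intro AE_I2 mult_mono power_mono grid_round_bound) (auto simp: quad_measure_def)
qed (auto intro!: measurable_quad_measure borel_measurable_times borel_measurable_power grid_round_measurable
  borel_measurable_continuous_onI continuous_intros measurable_compose[OF grid_round_measurable])

end

text \<open>
  Spectral sums over the cells of a grid of mesh \<open>1 / k\<close> approximate the operator in norm by
  polarization, which makes the weak spectral representation multiplicative in the limit.
\<close>

lemma moment_spectral:
  assumes T: "unitary_op T" and spec: "spectral_measure_of T E" and x: "x \<in> H"
  shows "moment (circle_measure (\<lambda>U. Re (ip (E U x) x))) i j = ip ((T ^^ i) x) ((T ^^ j) x)"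
proof -
  have pvm: "projection_valued_measure E"
    and T_int: "\<And>x. x \<in> H \<Longrightarrow> ip (T x) x = (LINT z|quad_measure E x. z)"
    using spec by (auto simp: spectral_measure_of_def quad_measure_def[OF spec[unfolded spectral_measure_of_def, THEN conjunct1]])
  note [simp] = grid_power_in[OF pvm]
  have T_lin: "linear_op T" and T_iso: "\<And>x. x \<in> H \<Longrightarrow> hnorm (T x) = hnorm x"
    using T by (auto simp: unitary_op_def hnorm_def)
  have T_in [simp]: "T y \<in> H" if "y \<in> H" for y using T_lin that by (simp add: linear_op_def)
  have T_diff: "T (y - z) = T y - T z" if "y \<in> H" "z \<in> H" for y z
  proof -
    have "T y = T ((y - z) + z)" by simp
    also have "\<dots> = T (y - z) + T z" using T_lin that unfolding linear_op_def by (blast intro: H_diff)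
    finally show ?thesis by simp
  qed
  have pow_in [simp]: "(T ^^ i) y \<in> H" if "y \<in> H" for i y using that by (induction i) auto
  \<comment> \<open>For exponent 0 the integrand is the constant 1, the quadratic forms agree
    exactly, and the bound applies with \<epsilon> = 0.\<close>
  have zero: "hnorm (y - grid_power E k 0 y) = 0" if y: "y \<in> H" for k y
  proof -
    have "hnorm (y - grid_power E k 0 y) \<le> 2 * 0 * hnorm y"
    proof (rule quadratic_form_bound[OF _ _ y])
      show "linear_op (\<lambda>y. y - grid_power E k 0 y)"
        using linear_op_grid_power[OF pvm, of k 0] by (auto simp: linear_op_def H_diff scale_right_diff_distrib)
      fix y assume y: "y \<in> H"
      interpret finite_measure "quad_measure E y" by (rule finite_quad_measure[OF pvm y])
      have "ip (grid_power E k 0 y) y = (LINT z|quad_measure E y. 1)"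
        using integral_grid_round[OF pvm y, where h = "\<lambda>_. 1" and k = k] unfolding grid_power_def[OF pvm]
        by (simp add: ip_sum pvm_in[OF pvm] y)
      also have "\<dots> = ip y y"
        using measure_quad_measure[OF pvm y, of "sphere 0 1"] sets.top[of circle_borel]
        by (simp add: quad_measure_def[OF pvm] pvm_total[OF pvm] y ip_self scaleR_conv_of_real)
      finally show "cmod (ip (y - grid_power E k 0 y) y) \<le> 0 * (hnorm y)\<^sup>2" by (simp add: ip_diff y)
    qed simp
    then show ?thesis using y hnorm_nonneg[OF H_diff[OF y grid_power_in[OF pvm y]], of k 0] by simp
  qed
  \<comment> \<open>The quadratic form of the difference is the integral of the rounding error
    against a measure of total mass \<open>(hnorm y)^2\<close>.\<close>
  have one: "hnorm (T y - grid_power E (Suc k) 1 y) \<le> 2 * (2 / real (Suc k)) * hnorm y" if y: "y \<in> H" for k y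
  proof (rule quadratic_form_bound[OF _ _ y])
    show "linear_op (\<lambda>y. T y - grid_power E (Suc k) 1 y)"
      using linear_op_grid_power[OF pvm, of "Suc k" 1] T_lin
      by (auto simp: linear_op_def H_diff scale_right_diff_distrib)
    fix y assume y: "y \<in> H"
    interpret finite_measure "quad_measure E y" by (rule finite_quad_measure[OF pvm y])
    have sp: "space (quad_measure E y) = sphere 0 1" by (simp add: quad_measure_def[OF pvm])
    have int: "integrable (quad_measure E y) (\<lambda>z. z)"
      by (rule integrable_const_bound[of _ 1]) (auto simp: sp intro!: AE_I2 measurable_quad_measure[OF pvm])
    have intg: "integrable (quad_measure E y) (grid_round (Suc k))"
      by (rule integrable_const_bound[of _ 3])
        (auto simp: sp intro!: AE_I2 measurable_quad_measure[OF pvm] grid_round_bound grid_round_measurable)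
    have "ip (grid_power E (Suc k) 1 y) y = (LINT z|quad_measure E y. grid_round (Suc k) z)"
      using integral_grid_round[OF pvm y, where h = "\<lambda>z. z" and k = "Suc k"] unfolding grid_power_def[OF pvm]
      by (simp add: ip_sum ip_scale H_scale pvm_in[OF pvm] y)
    then have "ip (T y - grid_power E (Suc k) 1 y) y = (LINT z|quad_measure E y. z - grid_round (Suc k) z)"
      using int intg by (simp add: ip_diff y T_int)
    also have "cmod \<dots> \<le> (LINT z|quad_measure E y. cmod (z - grid_round (Suc k) z))" by simp
    also have "\<dots> \<le> (LINT z|quad_measure E y. 2 / real (Suc k))"
      by (intro integral_mono integrable_norm Bochner_Integration.integrable_diff int intg grid_round_approx) simp_all
    also have "\<dots> = 2 / real (Suc k) * (hnorm y)\<^sup>2"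
      using measure_quad_measure[OF pvm y, of "sphere 0 1"] sets.top[of circle_borel]
      by (simp add: sp pvm_total[OF pvm] y ip_self)
    finally show "cmod (ip (T y - grid_power E (Suc k) 1 y) y) \<le> 2 / real (Suc k) * (hnorm y)\<^sup>2" .
  qed simp
  have conv: "(\<lambda>k. hnorm (grid_power E (Suc k) i x - (T ^^ i) x)) \<longlonglongrightarrow> 0" for i
  proof (induction i)
    case 0
    then show ?case using zero[OF x] x by (simp add: hnorm_minus_commute[of _ x])
  next
    case (Suc i)
    let ?d = "\<lambda>k. hnorm (grid_power E (Suc k) i x - (T ^^ i) x)"
    let ?e = "\<lambda>k. 2 * (2 / real (Suc k))"
    have "(\<lambda>k. 2 / real (Suc k)) \<longlonglongrightarrow> 0" by (intro LIMSEQ_Suc lim_const_over_n)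
    then have "(\<lambda>k. ?d k + ?e k * (?d k + hnorm ((T ^^ i) x))) \<longlonglongrightarrow> 0 + 2 * 0 * (0 + hnorm ((T ^^ i) x))"
      by (intro tendsto_intros Suc.IH)
    then have lim: "(\<lambda>k. ?d k + ?e k * (?d k + hnorm ((T ^^ i) x))) \<longlonglongrightarrow> 0" by simp
    show ?case
    proof (rule Lim_null_comparison[OF always_eventually lim], rule allI)
      fix k
      define S where "S = grid_power E (Suc k) i x"
      have S: "S \<in> H" by (simp add: S_def x)
      have S1: "grid_power E (Suc k) (Suc i) x = grid_power E (Suc k) 1 S"
        unfolding S_def by (simp add: grid_power_comp[OF pvm] x)
      \<comment> \<open>One new rounding error at \<open>S\<close>, plus the image under
        \<open>T\<close> of the previous error. As \<open>T\<close> is isometric, errors add up and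
        are not amplified; the length of \<open>S\<close> is bounded by that of its limit plus the
        previous error.\<close>
      have "grid_power E (Suc k) (Suc i) x - (T ^^ Suc i) x = (grid_power E (Suc k) 1 S - T S) + T (S - (T ^^ i) x)"
        by (simp add: S1 T_diff S x)
      also have "hnorm \<dots> \<le> hnorm (grid_power E (Suc k) 1 S - T S) + hnorm (T (S - (T ^^ i) x))"
        by (intro hnorm_triangle H_diff T_in) (simp_all add: S x)
      also have "\<dots> \<le> ?e k * hnorm S + ?d k"
        using one[OF S, of k] S x by (simp add: T_iso H_diff hnorm_minus_commute[of "T S"] flip: S_def)
      also have "?e k * hnorm S \<le> ?e k * (?d k + hnorm ((T ^^ i) x))"
        using hnorm_triangle[of "S - (T ^^ i) x" "(T ^^ i) x"] S x
        by (intro mult_left_mono) (simp_all add: H_diff flip: S_def)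
      finally have "hnorm (grid_power E (Suc k) (Suc i) x - (T ^^ Suc i) x) \<le>
          ?e k * (?d k + hnorm ((T ^^ i) x)) + ?d k" by simp
      then show "norm (hnorm (grid_power E (Suc k) (Suc i) x - (T ^^ Suc i) x)) \<le>
          ?d k + ?e k * (?d k + hnorm ((T ^^ i) x))"
        using hnorm_nonneg[OF H_diff[OF grid_power_in[OF pvm x] pow_in[OF x]], of "Suc k" "Suc i" "Suc i"]
        by (simp only: real_norm_def abs_of_nonneg add.commute)
    qed
  qed
  have "(\<lambda>k. ip (grid_power E (Suc k) i x) (grid_power E (Suc k) j x)) \<longlonglongrightarrow> ip ((T ^^ i) x) ((T ^^ j) x)"
    by (intro tendsto_ip conv) (simp_all add: x)
  then show ?thesis
    using tendsto_integral_grid_round[OF pvm x, of i j] LIMSEQ_unique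
    unfolding ip_grid_power[OF pvm x] quad_measure_def[OF pvm] by blast
qed

end

section \<open>Polar form of mpEDMD\<close>

lemma mat_adjoint_dim [simp]:
  "dim_row (mat_adjoint A) = dim_col A" "dim_col (mat_adjoint A) = dim_row A"
  by (auto simp: mat_adjoint_def mat_of_rows_def)

lemma mat_adjoint_carrier [simp]: "A \<in> carrier_mat m n \<Longrightarrow> mat_adjoint A \<in> carrier_mat n m"
  by (auto intro!: carrier_matI)

lemma mat_adjoint_index [simp]:
  fixes A :: "complex mat"
  assumes "i < dim_col A" "j < dim_row A"
  shows "mat_adjoint A $$ (i, j) = cnj (A $$ (j, i))"
  using assms by (simp add: mat_adjoint_def mat_of_rows_def)

lemma mat_adjoint_adjoint [simp]:
  fixes A :: "complex mat"
  shows "mat_adjoint (mat_adjoint A) = A"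
  by (intro eq_matI) auto

lemma cscalar_sum:
  fixes v w :: "complex vec"
  assumes "w \<in> carrier_vec n"
  shows "v \<bullet>c w = (\<Sum>i<n. vec_index v i * cnj (vec_index w i))"
  using assms by (simp add: scalar_prod_def atLeast0LessThan)

lemma mult_mat_vec_sum:
  assumes "A \<in> carrier_mat m n" "v \<in> carrier_vec n" "i < m"
  shows "vec_index (A *\<^sub>v v) i = (\<Sum>j<n. A $$ (i, j) * vec_index v j)"
  using assms by (simp add: scalar_prod_def atLeast0LessThan)

lemma mult_mat_sum:
  assumes "A \<in> carrier_mat m n" "B \<in> carrier_mat n l" "i < m" "j < l"
  shows "(A * B) $$ (i, j) = (\<Sum>k<n. A $$ (i, k) * B $$ (k, j))"
  using assms by (simp add: scalar_prod_def atLeast0LessThan)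

lemma mat_adjoint_mult:
  fixes A B :: "complex mat"
  assumes A: "A \<in> carrier_mat m n" and B: "B \<in> carrier_mat n l"
  shows "mat_adjoint (A * B) = mat_adjoint B * mat_adjoint A"
proof (rule eq_matI)
  fix i j assume "i < dim_row (mat_adjoint B * mat_adjoint A)" "j < dim_col (mat_adjoint B * mat_adjoint A)"
  then have ij: "i < l" "j < m" using A B by auto
  have "mat_adjoint (A * B) $$ (i, j) = cnj (\<Sum>k<n. A $$ (j, k) * B $$ (k, i))"
    using A B ij mult_mat_sum[OF A B ij(2,1)] by simp
  also have "\<dots> = (\<Sum>k<n. mat_adjoint B $$ (i, k) * mat_adjoint A $$ (k, j))"
    using A B ij by (simp add: mult.commute)
  also have "\<dots> = (mat_adjoint B * mat_adjoint A) $$ (i, j)"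
    using mult_mat_sum[OF mat_adjoint_carrier[OF B] mat_adjoint_carrier[OF A] ij] ..
  finally show "mat_adjoint (A * B) $$ (i, j) = (mat_adjoint B * mat_adjoint A) $$ (i, j)" .
qed (use A B in auto)

lemma cscalar_adjoint:
  fixes A :: "complex mat"
  assumes "A \<in> carrier_mat m n" "v \<in> carrier_vec n" "w \<in> carrier_vec m"
  shows "(A *\<^sub>v v) \<bullet>c w = v \<bullet>c (mat_adjoint A *\<^sub>v w)"
proof -
  have "(A *\<^sub>v v) \<bullet>c w = (\<Sum>i<m. \<Sum>j<n. A $$ (i, j) * vec_index v j * cnj (vec_index w i))"
    using assms by (simp add: cscalar_sum mult_mat_vec_sum sum_distrib_right del: index_mult_mat_vec)
  also have "\<dots> = (\<Sum>j<n. \<Sum>i<m. A $$ (i, j) * vec_index v j * cnj (vec_index w i))"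
    by (rule sum.swap)
  also have "\<dots> = v \<bullet>c (mat_adjoint A *\<^sub>v w)"
    using assms mult_mat_vec_carrier[OF mat_adjoint_carrier[OF assms(1)] assms(3)]
    by (simp add: cscalar_sum[of _ n] mult_mat_vec_sum[of "mat_adjoint A" n m] sum_distrib_left mult_ac
        del: index_mult_mat_vec)
  finally show ?thesis .
qed

lemma mat_diag_mult_vec:
  "v \<in> carrier_vec n \<Longrightarrow> j < n \<Longrightarrow> vec_index (mat_diag n f *\<^sub>v v) j = f j * vec_index v j"
  by (subst mult_mat_vec_sum[of _ n n]) (auto simp: mat_diag_def if_distrib[of "\<lambda>x. x * _"] cong: if_cong)

lemma mat_adjoint_diag:
  fixes f :: "nat \<Rightarrow> complex"
  shows "mat_adjoint (mat_diag n f) = mat_diag n (\<lambda>i. cnj (f i))"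
  by (intro eq_matI) (auto simp: mat_diag_def)

lemma unitary_mat_cancel:
  assumes "unitary_mat n U" "X \<in> carrier_mat n m"
  shows "mat_adjoint U * (U * X) = X" "U * (mat_adjoint U * X) = X"
proof -
  have U: "U \<in> carrier_mat n n" using assms by (simp add: unitary_mat_def)
  show "mat_adjoint U * (U * X) = X" "U * (mat_adjoint U * X) = X"
    using assms(1) left_mult_one_mat[OF assms(2)]
      assoc_mult_mat[OF U mat_adjoint_carrier[OF U] assms(2)]
      assoc_mult_mat[OF mat_adjoint_carrier[OF U] U assms(2)]
    by (simp_all add: unitary_mat_def)
qed

text \<open>
  \<open>W = Vh\<^sup>* G\<^sup>1\<^sup>/\<^sup>2\<close> diagonalizes the mpEDMD matrix, and \<open>diag lam * P\<close> is the polar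
  decomposition of the EDMD matrix \<open>G\<^sup>-\<^sup>1 A\<close> in the coordinates \<open>W\<close>.
\<close>

lemma mpEDMD_polar_form:
  assumes mp: "mpEDMD N G A K lam V" and A: "A \<in> carrier_mat N N"
  obtains W P where "W \<in> carrier_mat N N" "P \<in> carrier_mat N N" "W * V = 1\<^sub>m N" "V \<in> carrier_mat N N"
    "G = mat_adjoint W * W" "A = mat_adjoint W * (mat_diag N lam * (P * W))" "mat_adjoint P = P"
    "\<And>v. v \<in> carrier_vec N \<Longrightarrow> 0 \<le> Re ((P *\<^sub>v v) \<bullet>c v)" "\<And>j. j < N \<Longrightarrow> cmod (lam j) = 1"
proof -
  obtain R S U1 \<sigma> U2 Vh where R: "R \<in> carrier_mat N N" and Rh: "mat_adjoint R = R" and RR: "R * R = G"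
    and S: "S \<in> carrier_mat N N" and RS: "R * S = 1\<^sub>m N" and SR: "S * R = 1\<^sub>m N"
    and U1: "unitary_mat N U1" and U2: "unitary_mat N U2" and \<sigma>: "\<And>j. j < N \<Longrightarrow> 0 \<le> \<sigma> j"
    and B: "S * mat_adjoint A * S = U1 * mat_diag N (\<lambda>j. complex_of_real (\<sigma> j)) * mat_adjoint U2"
    and Vh: "unitary_mat N Vh" and eig: "U2 * mat_adjoint U1 = Vh * mat_diag N lam * mat_adjoint Vh"
    and V: "V = S * Vh"
    using mp unfolding mpEDMD_def psd_sqrt_mat_def is_svd_def by blast
  define Sg where "Sg = mat_diag N (\<lambda>j. complex_of_real (\<sigma> j))"
  define D where "D = mat_diag N lam"
  have [simp]: "U1 \<in> carrier_mat N N" "U2 \<in> carrier_mat N N" "Vh \<in> carrier_mat N N" "Sg \<in> carrier_mat N N"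
    "D \<in> carrier_mat N N" using U1 U2 Vh by (auto simp: unitary_mat_def Sg_def D_def)
  note [simp] = R S A mult_carrier_mat[of _ N N _ N] mult_mat_vec_carrier[of _ N N]
    assoc_mult_mat[of _ N N _ N _ N] assoc_mult_mat_vec[of _ N N _ N]
  note [simp] = mat_adjoint_carrier[OF A] mat_adjoint_carrier[OF \<open>U1 \<in> _\<close>] mat_adjoint_carrier[OF \<open>U2 \<in> _\<close>]
    mat_adjoint_carrier[OF \<open>Vh \<in> _\<close>]
  note assoc = assoc_mult_mat[of _ N N _ N _ N]
  note adj = mat_adjoint_mult[of _ N N _ N]
  note cancel = unitary_mat_cancel[OF U1, of _ N] unitary_mat_cancel[OF U2, of _ N] unitary_mat_cancel[OF Vh, of _ N]
  \<comment> \<open>The adjoint of the singular value decomposition reads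
    \<open>S * A * S = U2 * Sg * mat_adjoint U1\<close>, which is the unitary
    \<open>U2 * mat_adjoint U1\<close> times the positive \<open>U1 * Sg * mat_adjoint U1\<close>.
    Conjugation by \<open>Vh\<close> turns the first factor into \<open>D\<close> and the second
    into \<open>P\<close>.\<close>
  define W where "W = mat_adjoint Vh * R"
  define P where "P = mat_adjoint Vh * (U1 * (Sg * (mat_adjoint U1 * Vh)))"
  have Sgh: "mat_adjoint Sg = Sg" by (simp add: Sg_def mat_adjoint_diag)
  \<comment> \<open>\<open>S\<close> is given as the inverse of \<open>R\<close>; its adjoint
    inverts \<open>R\<close> too, because \<open>R\<close> is self-adjoint, so uniqueness of the
    inverse makes \<open>S\<close> self-adjoint.\<close>
  have "mat_adjoint S * R = 1\<^sub>m N"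
  proof -
    have "mat_adjoint S * R = mat_adjoint (R * S)" by (simp add: adj Rh)
    also have "\<dots> = 1\<^sub>m N" unfolding RS using mat_adjoint_diag[of N "\<lambda>_. 1"] by simp
    finally show ?thesis .
  qed
  then have Sh: "mat_adjoint S = S"
    using assoc[of "mat_adjoint S" R S] RS left_mult_one_mat[OF S]
      right_mult_one_mat[OF mat_adjoint_carrier[OF S]] by simp
  show ?thesis
  proof (rule that[of W P])
    show "W \<in> carrier_mat N N" "P \<in> carrier_mat N N" "V \<in> carrier_mat N N" by (simp_all add: W_def P_def V)
    have "W * V = mat_adjoint Vh * (R * (S * Vh))" by (simp add: W_def V)
    also have "R * (S * Vh) = Vh" using assoc[of R S Vh] RS left_mult_one_mat[OF \<open>Vh \<in> _\<close>] by simp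
    finally show "W * V = 1\<^sub>m N" using Vh by (simp add: unitary_mat_def)
    have Wh: "mat_adjoint W = R * Vh" by (simp add: W_def adj Rh)
    show "G = mat_adjoint W * W" unfolding Wh unfolding W_def by (simp add: cancel RR)
    show "mat_adjoint P = P" by (simp add: P_def adj Sgh)
    have "U2 * (Sg * mat_adjoint U1) = mat_adjoint (S * mat_adjoint A * S)"
      unfolding B Sg_def[symmetric] by (simp add: adj Sgh)
    also have "\<dots> = S * (A * S)" by (simp add: adj Sh)
    finally have B': "U2 * (Sg * mat_adjoint U1) = S * (A * S)" .
    have "mat_adjoint W * (D * (P * W)) = R * (Vh * (D * (mat_adjoint Vh * (U1 * (Sg * (mat_adjoint U1 * R))))))"
      unfolding Wh unfolding P_def W_def by (simp add: cancel)
    also have "Vh * (D * (mat_adjoint Vh * (U1 * (Sg * (mat_adjoint U1 * R)))))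
       = (U2 * mat_adjoint U1) * (U1 * (Sg * (mat_adjoint U1 * R)))"
      unfolding eig D_def[symmetric] by simp
    also have "\<dots> = (U2 * (Sg * mat_adjoint U1)) * R" by (simp add: cancel)
    also have "\<dots> = S * (A * (S * R))" unfolding B' by simp
    also have "R * \<dots> = R * S * A" using SR by (simp add: right_mult_one_mat[OF A])
    finally show "A = mat_adjoint W * (mat_diag N lam * (P * W))" using RS by (simp add: D_def left_mult_one_mat[OF A])
    show "0 \<le> Re ((P *\<^sub>v v) \<bullet>c v)" if v: "v \<in> carrier_vec N" for v
    proof -
      define Z where "Z = mat_adjoint U1 * Vh"
      define u where "u = Z *\<^sub>v v"
      have Z: "Z \<in> carrier_mat N N" by (simp add: Z_def)
      have u: "u \<in> carrier_vec N" using Z v by (simp add: u_def)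
      have P: "P = mat_adjoint Z * (Sg * Z)" by (simp add: P_def Z_def adj)
      have "(P *\<^sub>v v) \<bullet>c v = (mat_adjoint Z *\<^sub>v (Sg *\<^sub>v u)) \<bullet>c v"
        using Z v mat_adjoint_carrier[OF Z] by (simp add: P u_def)
      also have "\<dots> = (Sg *\<^sub>v u) \<bullet>c u"
        using cscalar_adjoint[OF mat_adjoint_carrier[OF Z] mult_mat_vec_carrier[OF _ u] v, of Sg] Z
        by (simp add: u_def)
      also have "\<dots> = (\<Sum>j<N. of_real (\<sigma> j) * (vec_index u j * cnj (vec_index u j)))"
        using u by (simp add: cscalar_sum Sg_def mat_diag_mult_vec mult.assoc del: index_mult_mat_vec)
      finally show ?thesis using \<sigma> by (auto intro!: sum_nonneg simp flip: complex_norm_square of_real_power)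
    qed
    show "cmod (lam j) = 1" if j: "j < N" for j
    proof -
      \<comment> \<open>\<open>D\<close> is a product of unitary matrices, hence unitary, and the
        diagonal of \<open>mat_adjoint D * D\<close> then yields the moduli.\<close>
      have D_eq: "D = mat_adjoint Vh * (U2 * (mat_adjoint U1 * Vh))"
      proof -
        have "mat_adjoint Vh * (U2 * (mat_adjoint U1 * Vh)) = mat_adjoint Vh * ((U2 * mat_adjoint U1) * Vh)" by simp
        also have "\<dots> = D * (mat_adjoint Vh * Vh)" unfolding eig D_def[symmetric] by (simp add: cancel)
        finally show ?thesis using Vh by (simp add: unitary_mat_def right_mult_one_mat[OF \<open>D \<in> _\<close>])
      qed
      have "mat_adjoint D * D = mat_adjoint Vh * Vh" unfolding D_eq by (simp add: adj cancel)
      then have "mat_diag N (\<lambda>j. cnj (lam j) * lam j) = 1\<^sub>m N"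
        using Vh by (simp add: D_def mat_adjoint_diag unitary_mat_def)
      then have "mat_diag N (\<lambda>j. cnj (lam j) * lam j) $$ (j, j) = 1\<^sub>m N $$ (j, j)" by simp
      then have "lam j * cnj (lam j) = 1" using j by (simp add: mat_diag_def mult.commute)
      then have "complex_of_real ((cmod (lam j))\<^sup>2) = 1" unfolding complex_norm_square .
      then have "(cmod (lam j))\<^sup>2 = 1" by (simp only: of_real_eq_1_iff)
      then show ?thesis by (simp add: power2_eq_1_iff) (use norm_ge_zero[of "lam j"] in linarith)
    qed
  qed
qed

text \<open>Taken on functions of the index instead of vectors, so that entrywise products with
  eigenvalues need no carrier conditions.\<close>

definition cvec_norm :: "nat \<Rightarrow> (nat \<Rightarrow> complex) \<Rightarrow> real" where
  "cvec_norm N u = L2_set (\<lambda>j. cmod (u j)) {..<N}"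

lemma cvec_norm_triangle: "cvec_norm N (\<lambda>j. u j + v j) \<le> cvec_norm N u + cvec_norm N v"
proof -
  have "cvec_norm N (\<lambda>j. u j + v j) \<le> L2_set (\<lambda>j. cmod (u j) + cmod (v j)) {..<N}"
    unfolding cvec_norm_def by (intro L2_set_mono norm_triangle_ineq) simp
  also have "\<dots> \<le> cvec_norm N u + cvec_norm N v" unfolding cvec_norm_def by (rule L2_set_triangle_ineq)
  finally show ?thesis .
qed

lemma cvec_norm_cong: "(\<And>j. j < N \<Longrightarrow> cmod (u j) = cmod (v j)) \<Longrightarrow> cvec_norm N u = cvec_norm N v"
  unfolding cvec_norm_def by (intro L2_set_cong) auto

lemma cvec_norm_nonneg [simp]: "0 \<le> cvec_norm N u"
  by (simp add: cvec_norm_def)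

lemma cvec_norm_sq: "(cvec_norm N u)\<^sup>2 = (\<Sum>j<N. (cmod (u j))\<^sup>2)"
  by (simp add: cvec_norm_def L2_set_def sum_nonneg)

lemma cvec_norm_inner: "cmod (\<Sum>j<N. u j * cnj (v j)) \<le> cvec_norm N u * cvec_norm N v"
proof -
  have "cmod (\<Sum>j<N. u j * cnj (v j)) \<le> (\<Sum>j<N. \<bar>cmod (u j)\<bar> * \<bar>cmod (v j)\<bar>)"
    by (rule sum_norm_le) (simp add: norm_mult)
  also have "\<dots> \<le> cvec_norm N u * cvec_norm N v" unfolding cvec_norm_def by (rule L2_set_mult_ineq)
  finally show ?thesis .
qed

text \<open>In the expanded square the cross term is twice the real part of the form of
  \<open>P\<close>, hence nonnegative. This serves as a lower bound for \<open>I + P\<close> without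
  inverting it.\<close>

lemma cvec_norm_le_add_psd:
  assumes P: "P \<in> carrier_mat N N" "mat_adjoint P = P" "0 \<le> Re ((P *\<^sub>v y) \<bullet>c y)" and y: "y \<in> carrier_vec N"
  shows "cvec_norm N (vec_index y) \<le> cvec_norm N (vec_index (y + P *\<^sub>v y))"
proof (rule power2_le_imp_le)
  define z where "z = P *\<^sub>v y"
  have z: "z \<in> carrier_vec N" using P y by (simp add: z_def)
  have "(cmod (a + b))\<^sup>2 = (cmod a)\<^sup>2 + 2 * Re (b * cnj a) + (cmod b)\<^sup>2" for a b
    by (simp add: cmod_power2 power2_sum algebra_simps)
  then have "(cvec_norm N (vec_index (y + z)))\<^sup>2 = (cvec_norm N (vec_index y))\<^sup>2 + 2 * Re (z \<bullet>c y) + (cvec_norm N (vec_index z))\<^sup>2"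
    using y z by (simp add: cvec_norm_sq cscalar_sum sum.distrib sum_distrib_left)
  then show "(cvec_norm N (vec_index y))\<^sup>2 \<le> (cvec_norm N (vec_index (y + P *\<^sub>v y)))\<^sup>2"
    using P(3) by (simp add: z_def)
qed simp

text \<open>The columns of \<open>V\<close> are orthonormal for the inner product of
  \<open>G\<close>, so these are the coefficients of \<open>v\<close> in the eigenvector basis.
  Their squared moduli are the atoms' weights before normalization.\<close>

definition eigen_coord :: "complex mat \<Rightarrow> complex mat \<Rightarrow> complex vec \<Rightarrow> nat \<Rightarrow> complex" where
  "eigen_coord G V v j = (G *\<^sub>v v) \<bullet>c col V j"

text \<open>
  In the last claim \<open>f\<close> and \<open>q\<close> are the defects \<open>T a - b\<close> and \<open>a - T\<^sup>* T a\<close> of the EDMD matrix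
  \<open>T = G\<^sup>-\<^sup>1 A\<close>, with the adjoint taken for the inner product of \<open>G\<close>.
\<close>

lemma mpEDMD_eigen_coord:
  assumes mp: "mpEDMD N G A K lam V" and A: "A \<in> carrier_mat N N" 
  shows "j < N \<Longrightarrow> cmod (lam j) = 1"
    and "a \<in> carrier_vec N \<Longrightarrow> b \<in> carrier_vec N \<Longrightarrow>
      (\<Sum>j<N. eigen_coord G V a j * cnj (eigen_coord G V b j)) = (G *\<^sub>v a) \<bullet>c b"
    and "a \<in> carrier_vec N \<Longrightarrow> b \<in> carrier_vec N \<Longrightarrow> f \<in> carrier_vec N \<Longrightarrow> q \<in> carrier_vec N \<Longrightarrow>
      G *\<^sub>v f = A *\<^sub>v a - G *\<^sub>v b \<Longrightarrow> G *\<^sub>v q = G *\<^sub>v a - mat_adjoint A *\<^sub>v (b + f) \<Longrightarrow>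
      cvec_norm N (\<lambda>j. lam j * eigen_coord G V a j - eigen_coord G V b j) \<le>
        cvec_norm N (eigen_coord G V f) + cvec_norm N (eigen_coord G V q)"
proof -
  obtain W P where W: "W \<in> carrier_mat N N" and P: "P \<in> carrier_mat N N" and WV: "W * V = 1\<^sub>m N"
    and V: "V \<in> carrier_mat N N" and G: "G = mat_adjoint W * W"
    and A_eq: "A = mat_adjoint W * (mat_diag N lam * (P * W))" and Ph: "mat_adjoint P = P"
    and psd: "\<And>v. v \<in> carrier_vec N \<Longrightarrow> 0 \<le> Re ((P *\<^sub>v v) \<bullet>c v)"
    and lam: "\<And>j. j < N \<Longrightarrow> cmod (lam j) = 1"
    using mpEDMD_polar_form[OF mp A] by blast
  define D where "D = mat_diag N lam"
  have D: "D \<in> carrier_mat N N" by (simp add: D_def)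
  note [simp] = mult_carrier_mat[of _ N N _ N] mult_mat_vec_carrier[of _ N N]
    assoc_mult_mat[of _ N N _ N _ N] assoc_mult_mat_vec[of _ N N _ N]
  note [simp] = W P V D mat_adjoint_carrier[OF W] mat_adjoint_carrier[OF D] mat_adjoint_carrier[OF V]
  \<comment> \<open>\<open>W\<close> sends the columns of \<open>V\<close> to unit vectors. In these
    coordinates the inner product of \<open>G\<close> is the Euclidean one.\<close>
  have coord: "eigen_coord G V v j = vec_index (W *\<^sub>v v) j" if v: "v \<in> carrier_vec N" and j: "j < N" for v j
  proof -
    have Wv: "W *\<^sub>v v \<in> carrier_vec N" using v by simp
    have "eigen_coord G V v j = (mat_adjoint W *\<^sub>v (W *\<^sub>v v)) \<bullet>c col V j"
      using v by (simp add: eigen_coord_def G)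
    also have "\<dots> = (W *\<^sub>v v) \<bullet>c (W *\<^sub>v col V j)"
      using cscalar_adjoint[OF mat_adjoint_carrier[OF W] Wv, of "col V j"] j by simp
    also have "W *\<^sub>v col V j = unit_vec N j"
      using col_mult2[OF W V j] j by (simp add: WV)
    also have "(W *\<^sub>v v) \<bullet>c unit_vec N j = vec_index (W *\<^sub>v v) j"
      using j by (simp add: cscalar_sum[of _ N] if_distrib cong: if_cong del: index_mult_mat_vec)
    finally show ?thesis .
  qed
  show "cmod (lam j) = 1" if "j < N" for j using lam[OF that] .
  show "(\<Sum>j<N. eigen_coord G V a j * cnj (eigen_coord G V b j)) = (G *\<^sub>v a) \<bullet>c b"
    if a: "a \<in> carrier_vec N" and b: "b \<in> carrier_vec N" for a b
  proof -
    have "(G *\<^sub>v a) \<bullet>c b = (mat_adjoint W *\<^sub>v (W *\<^sub>v a)) \<bullet>c b" using a by (simp add: G)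
    also have "\<dots> = (W *\<^sub>v a) \<bullet>c (W *\<^sub>v b)"
      using cscalar_adjoint[OF mat_adjoint_carrier[OF W], of "W *\<^sub>v a" b] a b by simp
    also have "\<dots> = (\<Sum>j<N. eigen_coord G V a j * cnj (eigen_coord G V b j))"
      using a b by (simp add: cscalar_sum[of "W *\<^sub>v b" N] coord del: index_mult_mat_vec)
    finally show ?thesis ..
  qed
  have inj: "y = z" if "mat_adjoint W *\<^sub>v y = mat_adjoint W *\<^sub>v z" "y \<in> carrier_vec N" "z \<in> carrier_vec N" for y z
  proof -
    have "mat_adjoint V * mat_adjoint W = 1\<^sub>m N"
      using mat_adjoint_mult[OF W V] mat_adjoint_diag[of N "\<lambda>_. 1"] by (simp add: WV)
    then have "mat_adjoint V *\<^sub>v (mat_adjoint W *\<^sub>v v) = v" if "v \<in> carrier_vec N" for v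
      using that assoc_mult_mat_vec[OF mat_adjoint_carrier[OF V] mat_adjoint_carrier[OF W] that] by simp
    then show ?thesis using that by metis
  qed
  show "cvec_norm N (\<lambda>j. lam j * eigen_coord G V a j - eigen_coord G V b j) \<le>
        cvec_norm N (eigen_coord G V f) + cvec_norm N (eigen_coord G V q)"
    if ab: "a \<in> carrier_vec N" "b \<in> carrier_vec N" "f \<in> carrier_vec N" "q \<in> carrier_vec N"
      and f: "G *\<^sub>v f = A *\<^sub>v a - G *\<^sub>v b" and q: "G *\<^sub>v q = G *\<^sub>v a - mat_adjoint A *\<^sub>v (b + f)" for a b f q
  proof -
    note [simp] = ab
    define h where "h = W *\<^sub>v a"
    have h [simp]: "h \<in> carrier_vec N" by (simp add: h_def)
    have Aa: "A *\<^sub>v a = mat_adjoint W *\<^sub>v (D *\<^sub>v (P *\<^sub>v h))" by (simp add: A_eq h_def flip: D_def)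
    have Gv: "G *\<^sub>v v = mat_adjoint W *\<^sub>v (W *\<^sub>v v)" if "v \<in> carrier_vec N" for v using that by (simp add: G)
    have "A *\<^sub>v a = G *\<^sub>v b + G *\<^sub>v f"
    proof -
      have "G *\<^sub>v b \<in> carrier_vec N" "A *\<^sub>v a \<in> carrier_vec N" using A by (simp_all add: G)
      then show ?thesis unfolding f by (intro eq_vecI) (auto dest!: carrier_vecD simp del: index_mult_mat_vec)
    qed
    also have "\<dots> = mat_adjoint W *\<^sub>v (W *\<^sub>v b + W *\<^sub>v f)"
      by (simp add: Gv mult_add_distrib_mat_vec[of _ N N])
    finally have DPh: "D *\<^sub>v (P *\<^sub>v h) = W *\<^sub>v b + W *\<^sub>v f"
      unfolding Aa by (rule inj) simp_all
    have DD: "mat_adjoint D *\<^sub>v (D *\<^sub>v v) = v" if v: "v \<in> carrier_vec N" for v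
    proof (rule eq_vecI)
      fix j assume "j < dim_vec v"
      then have j: "j < N" using v by simp
      have "cnj (lam j) * lam j = 1" using lam[OF j] complex_norm_square[of "lam j"] by (simp add: mult.commute)
      then show "vec_index (mat_adjoint D *\<^sub>v (D *\<^sub>v v)) j = vec_index v j"
        using v j unfolding D_def mat_adjoint_diag
        by (simp add: mat_diag_mult_vec del: index_mult_mat_vec flip: mult.assoc)
    qed (use v in \<open>simp add: mat_adjoint_diag D_def mat_diag_def\<close>)
    \<comment> \<open>In the coordinates \<open>W\<close> the operator \<open>T\<close> is
      \<open>D * P\<close>, so its adjoint is \<open>P\<close> times the adjoint of
      \<open>D\<close>. By \<open>DPh\<close> the vector \<open>b + f\<close> has coordinates
      \<open>D P h\<close>; the adjoint of \<open>D\<close> cancels \<open>D\<close> and leaves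
      \<open>P\<close> applied twice to \<open>h\<close>.\<close>
    have "mat_adjoint A = mat_adjoint W * (P * (mat_adjoint D * W))"
      unfolding A_eq D_def[symmetric] by (simp add: mat_adjoint_mult[of _ N N _ N] Ph)
    then have "mat_adjoint A *\<^sub>v (b + f) = mat_adjoint W *\<^sub>v (P *\<^sub>v (mat_adjoint D *\<^sub>v (W *\<^sub>v b + W *\<^sub>v f)))"
      by (simp add: mult_add_distrib_mat_vec[of W N N])
    also have "\<dots> = mat_adjoint W *\<^sub>v (P *\<^sub>v (P *\<^sub>v h))" by (simp add: DD flip: DPh)
    finally have "mat_adjoint W *\<^sub>v (W *\<^sub>v q) = mat_adjoint W *\<^sub>v (h - P *\<^sub>v (P *\<^sub>v h))"
      using q by (simp add: Gv h_def mult_minus_distrib_mat_vec[of _ N N])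
    then have Wq: "W *\<^sub>v q = h - P *\<^sub>v (P *\<^sub>v h)" by (rule inj) simp_all
    define y where "y = h - P *\<^sub>v h"
    have y [simp]: "y \<in> carrier_vec N" by (simp add: y_def)
    have "y + P *\<^sub>v y = W *\<^sub>v q"
      unfolding Wq y_def by (simp add: mult_minus_distrib_mat_vec[of P N N])
        (intro eq_vecI, auto)
    then have y_le: "cvec_norm N (vec_index y) \<le> cvec_norm N (vec_index (W *\<^sub>v q))"
      using cvec_norm_le_add_psd[OF P Ph psd[OF y] y] by simp
    \<comment> \<open>Since \<open>D P h = W b + W f\<close>, the difference
      \<open>D h - W b\<close> equals \<open>W f + D y\<close>; the unimodular \<open>D\<close> does
      not change the length of \<open>y\<close>.\<close>
    have "cvec_norm N (\<lambda>j. lam j * eigen_coord G V a j - eigen_coord G V b j)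
        = cvec_norm N (\<lambda>j. vec_index (W *\<^sub>v f) j + lam j * vec_index y j)"
    proof (rule cvec_norm_cong)
      fix j assume j: "j < N"
      have "vec_index (D *\<^sub>v (P *\<^sub>v h)) j = vec_index (W *\<^sub>v b) j + vec_index (W *\<^sub>v f) j"
        unfolding DPh using j carrier_matD[OF W] by simp
      then have "lam j * vec_index (P *\<^sub>v h) j = vec_index (W *\<^sub>v b) j + vec_index (W *\<^sub>v f) j"
        using j mult_mat_vec_carrier[OF P h] by (simp add: D_def mat_diag_mult_vec del: index_mult_mat_vec)
      moreover have "vec_index y j = vec_index h j - vec_index (P *\<^sub>v h) j"
        unfolding y_def using j h carrier_matD[OF P] by simp
      ultimately show "cmod (lam j * eigen_coord G V a j - eigen_coord G V b j) =
          cmod (vec_index (W *\<^sub>v f) j + lam j * vec_index y j)"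
        using j by (simp add: coord right_diff_distrib flip: h_def del: index_mult_mat_vec)
    qed
    also have "\<dots> \<le> cvec_norm N (vec_index (W *\<^sub>v f)) + cvec_norm N (\<lambda>j. lam j * vec_index y j)" by (rule cvec_norm_triangle)
    also have "cvec_norm N (\<lambda>j. lam j * vec_index y j) = cvec_norm N (vec_index y)"
      by (rule cvec_norm_cong) (simp add: norm_mult lam)
    also have "cvec_norm N (vec_index (W *\<^sub>v f)) + cvec_norm N (vec_index y) \<le>
       cvec_norm N (eigen_coord G V f) + cvec_norm N (eigen_coord G V q)"
      using y_le cvec_norm_cong[of N "eigen_coord G V f" "vec_index (W *\<^sub>v f)"]
        cvec_norm_cong[of N "eigen_coord G V q" "vec_index (W *\<^sub>v q)"] coord by simp
    finally show ?thesis .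
  qed
qed

text \<open>Normalizing \<open>c\<close> divides every weight by the squared norm of
  \<open>c\<close> for \<open>G\<close>, and the weights of \<open>c\<close> sum to that number by
  Parseval in the eigenvector basis. In the limit argument positivity comes from the convergence of
  this number to 1.\<close>

lemma mpEDMD_measure_moment:
  fixes c :: "complex vec" and G V :: "complex mat"
  assumes mp: "mpEDMD N G A K lam V" and A: "A \<in> carrier_mat N N" and G: "G \<in> carrier_mat N N"
    and c: "c \<in> carrier_vec N" and pos: "0 < Re ((G *\<^sub>v c) \<bullet>c c)"
  defines "\<mu> \<equiv> mpEDMD_measure N G lam V (normalize_coeffs G c)"
  shows "circle_prob \<mu>"
    and "moment \<mu> i j = (\<Sum>n<N. of_real ((cmod (eigen_coord G V c n))\<^sup>2) * (lam n ^ i * cnj (lam n) ^ j))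
      / of_real (Re ((G *\<^sub>v c) \<bullet>c c))"
proof -
  define \<rho> where "\<rho> = Re ((G *\<^sub>v c) \<bullet>c c)"
  define p where "p n = (cmod (eigen_coord G V c n))\<^sup>2 / \<rho>" for n
  have "(cmod ((G *\<^sub>v normalize_coeffs G c) \<bullet>c col V n))\<^sup>2 = p n" if "n < N" for n
  proof -
    obtain W P where V: "V \<in> carrier_mat N N" using mpEDMD_polar_form[OF mp A] by metis
    have Gc: "G *\<^sub>v normalize_coeffs G c = complex_of_real (1 / sqrt \<rho>) \<cdot>\<^sub>v (G *\<^sub>v c)"
      unfolding normalize_coeffs_def \<rho>_def[symmetric] by (rule mult_mat_vec[OF G c])
    have "(G *\<^sub>v normalize_coeffs G c) \<bullet>c col V n = complex_of_real (1 / sqrt \<rho>) * eigen_coord G V c n"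
      unfolding Gc eigen_coord_def
      by (rule smult_scalar_prod_distrib[of _ N])
        (use mult_mat_vec_carrier[OF G c] V that in \<open>auto intro!: carrier_vec_conjugate\<close>)
    then show ?thesis
      using pos by (simp add: p_def norm_mult norm_divide power_mult_distrib power_divide flip: \<rho>_def)
  qed
  then have \<mu>: "\<mu> = circle_measure (\<lambda>U. \<Sum>n | n < N \<and> lam n \<in> U. p n)"
    unfolding \<mu>_def mpEDMD_measure_def by simp
  have p: "0 \<le> p n" for n using pos by (simp add: p_def flip: \<rho>_def)
  note lam = mpEDMD_eigen_coord(1)[OF mp A]
  have "complex_of_real (\<Sum>n<N. (cmod (eigen_coord G V c n))\<^sup>2) = (G *\<^sub>v c) \<bullet>c c"
    unfolding mpEDMD_eigen_coord(2)[OF mp A c c, symmetric] of_real_sum complex_norm_square ..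
  then have "(\<Sum>n<N. (cmod (eigen_coord G V c n))\<^sup>2) = \<rho>" by (metis Re_complex_of_real \<rho>_def)
  then have "(\<Sum>n<N. p n) = 1" using pos by (simp add: p_def flip: sum_divide_distrib \<rho>_def)
  then show "circle_prob \<mu>" unfolding \<mu> using circle_prob_atomic[of N lam p] lam p by blast
  have "moment \<mu> i j = (\<Sum>n<N. of_real (p n) * (lam n ^ i * cnj (lam n) ^ j))"
    unfolding \<mu> by (rule moment_atomic) (use lam p in auto)
  then show "moment \<mu> i j = (\<Sum>n<N. of_real ((cmod (eigen_coord G V c n))\<^sup>2) * (lam n ^ i * cnj (lam n) ^ j))
      / of_real (Re ((G *\<^sub>v c) \<bullet>c c))"
    by (simp add: p_def sum_divide_distrib flip: \<rho>_def)
qed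

section \<open>The Koopman operator on square integrable functions\<close>

lemma L2_mult_integrable:
  assumes f: "f \<in> L2 \<omega>" and g: "g \<in> L2 \<omega>"
  shows "integrable \<omega> (\<lambda>z. f z * cnj (g z))"
proof (rule Bochner_Integration.integrable_bound)
  have meas: "f \<in> borel_measurable \<omega>" "g \<in> borel_measurable \<omega>" using f g by (simp_all add: L2_def)
  show "integrable \<omega> (\<lambda>z. (cmod (f z))\<^sup>2 + (cmod (g z))\<^sup>2)" using f g by (simp add: L2_def)
  have "(\<lambda>z. cnj (g z)) \<in> borel_measurable \<omega>"
    using meas(2) by (rule measurable_compose) (intro borel_measurable_continuous_onI continuous_intros)
  then show "(\<lambda>z. f z * cnj (g z)) \<in> borel_measurable \<omega>"
    using meas(1) by (intro borel_measurable_times)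
  have "cmod a * cmod b \<le> (cmod a)\<^sup>2 + (cmod b)\<^sup>2" for a b
    using sum_squares_bound[of "cmod a" "cmod b"] mult_nonneg_nonneg[OF norm_ge_zero norm_ge_zero, of a b]
    by linarith
  then show "AE z in \<omega>. norm (f z * cnj (g z)) \<le> norm ((cmod (f z))\<^sup>2 + (cmod (g z))\<^sup>2)"
    by (simp add: norm_mult)
qed

lemma l2_inner_cnj: "l2_inner \<omega> g f = cnj (l2_inner \<omega> f g)"
proof -
  have "l2_inner \<omega> g f = (LINT z|\<omega>. cnj (f z * cnj (g z)))" by (simp add: l2_inner_def mult.commute)
  also have "\<dots> = cnj (l2_inner \<omega> f g)" unfolding l2_inner_def by (rule Bochner_Integration.integral_cnj)
  finally show ?thesis .
qed

lemma l2_inner_cong_AE: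
  assumes "f \<in> L2 \<omega>" "f' \<in> L2 \<omega>" "g \<in> L2 \<omega>" "g' \<in> L2 \<omega>"
    and "AE z in \<omega>. f z = f' z" "AE z in \<omega>. g z = g' z"
  shows "l2_inner \<omega> f g = l2_inner \<omega> f' g'"
  unfolding l2_inner_def
proof (rule integral_cong_AE)
  show "AE z in \<omega>. f z * cnj (g z) = f' z * cnj (g' z)" using assms(5,6) by eventually_elim simp
qed (use L2_mult_integrable assms borel_measurable_integrable in blast)+

lemma L2_scale: "f \<in> L2 \<omega> \<Longrightarrow> (\<lambda>z. a * f z) \<in> L2 \<omega>"
  by (auto simp: L2_def norm_mult power_mult_distrib intro!: borel_measurable_times)

lemma L2_add:
  assumes "f \<in> L2 \<omega>" "g \<in> L2 \<omega>"
  shows "(\<lambda>z. f z + g z) \<in> L2 \<omega>"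
proof -
  have meas: "(\<lambda>z. f z + g z) \<in> borel_measurable \<omega>"
    using assms by (intro borel_measurable_add) (simp_all add: L2_def)
  moreover have "integrable \<omega> (\<lambda>z. (cmod (f z + g z))\<^sup>2)"
  proof (rule Bochner_Integration.integrable_bound)
    show "integrable \<omega> (\<lambda>z. 2 * (cmod (f z))\<^sup>2 + 2 * (cmod (g z))\<^sup>2)" using assms by (simp add: L2_def)
    show "(\<lambda>z. (cmod (f z + g z))\<^sup>2) \<in> borel_measurable \<omega>"
      using meas by (intro borel_measurable_power measurable_compose[OF meas borel_measurable_norm])
    have "(cmod (a + b))\<^sup>2 \<le> 2 * (cmod a)\<^sup>2 + 2 * (cmod b)\<^sup>2" for a b
    proof -
      have "(cmod (a + b))\<^sup>2 \<le> (cmod a + cmod b)\<^sup>2" by (intro power_mono norm_triangle_ineq) simp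
      also have "\<dots> \<le> 2 * (cmod a)\<^sup>2 + 2 * (cmod b)\<^sup>2"
        using sum_squares_bound[of "cmod a" "cmod b"] by (simp add: power2_sum)
      finally show ?thesis .
    qed
    then show "AE z in \<omega>. norm ((cmod (f z + g z))\<^sup>2) \<le> norm (2 * (cmod (f z))\<^sup>2 + 2 * (cmod (g z))\<^sup>2)"
      by simp
  qed
  ultimately show ?thesis by (simp add: L2_def)
qed

lemma L2_synth:
  assumes "\<And>j. j < N \<Longrightarrow> \<psi> j \<in> L2 \<omega>"
  shows "synth N \<psi> c \<in> L2 \<omega>"
  unfolding synth_def using assms
proof (induction N)
  case 0
  then show ?case by (simp add: L2_def)
next
  case (Suc N)
  then show ?case by (simp add: L2_add L2_scale)
qed

lemma l2_inner_synth_left: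
  assumes "\<And>j. j < N \<Longrightarrow> \<psi> j \<in> L2 \<omega>" "h \<in> L2 \<omega>"
  shows "l2_inner \<omega> (synth N \<psi> c) h = (\<Sum>j<N. vec_index c j * l2_inner \<omega> (\<psi> j) h)"
proof -
  have "l2_inner \<omega> (synth N \<psi> c) h = (LINT z|\<omega>. (\<Sum>j<N. vec_index c j * (\<psi> j z * cnj (h z))))"
    by (simp add: l2_inner_def synth_def sum_distrib_right mult.assoc)
  then show ?thesis
    using assms by (simp add: l2_inner_def L2_mult_integrable)
qed

lemma l2_inner_synth_right:
  assumes "\<And>j. j < N \<Longrightarrow> \<psi> j \<in> L2 \<omega>" "h \<in> L2 \<omega>"
  shows "l2_inner \<omega> h (synth N \<psi> c) = (\<Sum>j<N. cnj (vec_index c j) * l2_inner \<omega> h (\<psi> j))"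
  unfolding l2_inner_cnj[of \<omega> h] by (simp add: l2_inner_synth_left[OF assms] flip: l2_inner_cnj)

context
  fixes d \<omega> F assumes mps: "measure_preserving_system d \<omega> F"
begin

lemma F_measurable: "F \<in> \<omega> \<rightarrow>\<^sub>M \<omega>" and F_distr: "distr \<omega> \<omega> F = \<omega>"
  using mps by (auto simp: measure_preserving_system_def)

lemma koopman_L2: "f \<in> L2 \<omega> \<Longrightarrow> koopman F f \<in> L2 \<omega>"
proof -
  assume f: "f \<in> L2 \<omega>"
  then have "integrable (distr \<omega> \<omega> F) (\<lambda>z. (cmod (f z))\<^sup>2)" by (simp add: F_distr L2_def)
  then have "integrable \<omega> (\<lambda>z. (cmod (f (F z)))\<^sup>2)"
    using integrable_distr[OF F_measurable] by blast
  then show ?thesis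
    using f measurable_comp[OF F_measurable] by (auto simp: L2_def koopman_def)
qed

lemma koopman_pow_L2: "f \<in> L2 \<omega> \<Longrightarrow> (koopman F ^^ k) f \<in> L2 \<omega>"
  by (induction k) (auto intro: koopman_L2)

lemma koopman_isometry:
  assumes "f \<in> L2 \<omega>" "g \<in> L2 \<omega>"
  shows "l2_inner \<omega> (koopman F f) (koopman F g) = l2_inner \<omega> f g"
proof -
  have "(\<lambda>z. f z * cnj (g z)) \<in> borel_measurable \<omega>"
    using L2_mult_integrable[OF assms] by (rule borel_measurable_integrable)
  from integral_distr[OF F_measurable this] show ?thesis
    by (simp add: F_distr l2_inner_def koopman_def)
qed

text \<open>Preimages of null sets are null since \<open>F\<close> preserves \<omega>. Expansions in
  the dictionary, valid only almost everywhere, can therefore be composed with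
  \<open>F\<close>.\<close>

lemma koopman_cong_AE:
  assumes "AE z in \<omega>. f z = g z"
  shows "AE z in \<omega>. koopman F f z = koopman F g z"
  using AE_distrD[OF F_measurable, unfolded F_distr, OF assms] by (simp add: koopman_def)

lemma koopman_synth: "koopman F (synth N \<psi> c) = synth N (\<lambda>j. koopman F (\<psi> j)) c"
  by (auto simp: koopman_def synth_def)

end

section \<open>Moments of the spectral measure of the Koopman operator\<close>

context koopman_unitary_extension
begin

text \<open>The residual of the orthogonal projection pairs to zero with \<open>J g\<close>, so the
  compression is invisible in the quadratic form and the measure can be computed in the larger
  space.\<close>

lemma scalar_spectral_measure_eq:
  assumes comp: "compression E" and g: "g \<in> L2 \<omega>"
  shows "scalar_spectral_measure \<omega> E g = circle_measure (\<lambda>U. Re (ip (E' U (J g)) (J g)))"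
  unfolding scalar_spectral_measure_def
proof (rule circle_measure_cong)
  fix U assume U: "U \<in> sets circle_borel"
  have pvm: "projection_valued_measure E'" using spectral by (simp add: spectral_measure_of_def)
  have E: "E U g \<in> L2 \<omega>" and orth: "is_orthogonal_projection (J ` L2 \<omega>) (E' U (J g)) (J (E U g))"
    using comp U g by (auto simp: compression_def)
  have "ip (E' U (J g) - J (E U g)) (J g) = 0" using orth g by (auto simp: is_orthogonal_projection_def)
  then have "ip (E' U (J g)) (J g) = ip (J (E U g)) (J g)"
    using ip_diff[OF pvm_in[OF pvm U] J_in[OF E] J_in[OF g]] J_in[OF g] by simp
  then show "Re (l2_inner \<omega> (E U g) g) = Re (ip (E' U (J g)) (J g))"
    by (simp add: J_isometric E g)
qed

lemma moment_scalar_spectral_measure: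
  assumes mps: "measure_preserving_system d \<omega> F" and comp: "compression E" and g: "g \<in> L2 \<omega>"
  shows "moment (scalar_spectral_measure \<omega> E g) i j = l2_inner \<omega> ((koopman F ^^ i) g) ((koopman F ^^ j) g)"
proof -
  have pow: "(K' ^^ k) (J g) = J ((koopman F ^^ k) g)" for k
    by (induction k) (simp_all add: extends koopman_pow_L2[OF mps g])
  have "moment (scalar_spectral_measure \<omega> E g) i j = ip ((K' ^^ i) (J g)) ((K' ^^ j) (J g))"
    unfolding scalar_spectral_measure_eq[OF comp g]
    by (rule moment_spectral[OF unitary spectral J_in[OF g]])
  then show ?thesis by (simp add: pow J_isometric koopman_pow_L2[OF mps g])
qed

lemma circle_prob_scalar_spectral_measure:
  assumes comp: "compression E" and g: "g \<in> L2 \<omega>" and norm: "l2_inner \<omega> g g = 1"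
  shows "circle_prob (scalar_spectral_measure \<omega> E g)"
proof -
  have pvm: "projection_valued_measure E'" using spectral by (simp add: spectral_measure_of_def)
  have "hnorm (J g) = 1" by (simp add: hnorm_def J_isometric g norm)
  then show ?thesis
    using circle_prob_quad_measure[OF pvm J_in[OF g]]
    by (simp add: scalar_spectral_measure_eq[OF comp g] quad_measure_def[OF pvm])
qed

end

text \<open>The row index belongs to the second argument of \<open>l2_inner\<close>, as in the
  limits of \<open>G\<close> and \<open>A\<close>. Multiplication by a coefficient vector then tests
  the synthesized function against the dictionary.\<close>

definition gram_mat :: "point measure \<Rightarrow> nat \<Rightarrow> (nat \<Rightarrow> observable) \<Rightarrow> (nat \<Rightarrow> observable) \<Rightarrow> complex mat" where
  "gram_mat \<omega> N \<phi> \<psi> = Matrix.mat N N (\<lambda>(j, k). l2_inner \<omega> (\<phi> k) (\<psi> j))"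

lemma gram_mat_carrier [simp]: "gram_mat \<omega> N \<phi> \<psi> \<in> carrier_mat N N"
  by (simp add: gram_mat_def)

lemma gram_mat_mult_vec:
  assumes "\<And>j. j < N \<Longrightarrow> \<phi> j \<in> L2 \<omega>" "\<And>j. j < N \<Longrightarrow> \<psi> j \<in> L2 \<omega>" "c \<in> carrier_vec N" "j < N"
  shows "vec_index (gram_mat \<omega> N \<phi> \<psi> *\<^sub>v c) j = l2_inner \<omega> (synth N \<phi> c) (\<psi> j)"
  unfolding mult_mat_vec_sum[OF gram_mat_carrier assms(3,4)]
  using assms by (simp add: l2_inner_synth_left gram_mat_def mult.commute)

lemma gram_mat_adjoint: "mat_adjoint (gram_mat \<omega> N \<phi> \<psi>) = gram_mat \<omega> N \<psi> \<phi>"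
  by (rule eq_matI) (auto simp: gram_mat_def l2_inner_cnj[symmetric])

lemma gram_mat_cscalar:
  assumes \<psi>: "\<And>j. j < N \<Longrightarrow> \<psi> j \<in> L2 \<omega>" and "a \<in> carrier_vec N" "b \<in> carrier_vec N"
  shows "(gram_mat \<omega> N \<psi> \<psi> *\<^sub>v a) \<bullet>c b = l2_inner \<omega> (synth N \<psi> a) (synth N \<psi> b)"
  using assms
  by (simp add: cscalar_sum[of _ N] gram_mat_mult_vec l2_inner_synth_right[of N \<psi> \<omega> "synth N \<psi> a"] L2_synth
      mult.commute del: index_mult_mat_vec)

text \<open>The synthesis of a null vector has norm zero, hence vanishes almost everywhere, against
  linear independence. By continuity the determinant of \<open>G M\<close> is nonzero for large
  \<open>M\<close>.\<close>

lemma det_gram_mat: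
  assumes dict: "dictionary \<omega> N \<psi>"
  shows "Determinant.det (gram_mat \<omega> N \<psi> \<psi>) \<noteq> 0"
proof
  have \<psi>: "\<And>j. j < N \<Longrightarrow> \<psi> j \<in> L2 \<omega>" using dict by (simp add: dictionary_def)
  assume "Determinant.det (gram_mat \<omega> N \<psi> \<psi>) = 0"
  then obtain v where v: "v \<in> carrier_vec N" "v \<noteq> 0\<^sub>v N" "gram_mat \<omega> N \<psi> \<psi> *\<^sub>v v = 0\<^sub>v N"
    using det_0_iff_vec_prod_zero[OF gram_mat_carrier] by blast
  define f where "f = synth N \<psi> v"
  have f: "f \<in> L2 \<omega>" unfolding f_def by (rule L2_synth) (rule \<psi>)
  have "l2_inner \<omega> f f = 0"
    using gram_mat_cscalar[of N \<psi> \<omega> v v] \<psi> v by (simp add: f_def)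
  moreover have "l2_inner \<omega> f f = of_real (LINT z|\<omega>. (cmod (f z))\<^sup>2)"
    unfolding l2_inner_def by (simp flip: complex_norm_square of_real_power)
  ultimately have "(LINT z|\<omega>. (cmod (f z))\<^sup>2) = 0" by simp
  then have "AE z in \<omega>. (cmod (f z))\<^sup>2 = 0"
    using f by (subst (asm) integral_nonneg_eq_0_iff_AE) (auto simp: L2_def)
  then have "AE z in \<omega>. synth N \<psi> v z = 0" by (simp add: f_def)
  then show False using dict v by (auto simp: dictionary_def)
qed

section \<open>The large data limit\<close>

lemma tendsto_mult_mat_vec:
  fixes A :: "nat \<Rightarrow> complex mat"
  assumes A: "\<And>M. A M \<in> carrier_mat n n" "A' \<in> carrier_mat n n"
    and X: "\<And>M. X M \<in> carrier_vec n" "x \<in> carrier_vec n"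
    and lim: "\<And>i j. i < n \<Longrightarrow> j < n \<Longrightarrow> (\<lambda>M. A M $$ (i, j)) \<longlonglongrightarrow> A' $$ (i, j)"
      "\<And>i. i < n \<Longrightarrow> (\<lambda>M. vec_index (X M) i) \<longlonglongrightarrow> vec_index x i"
    and i: "i < n"
  shows "(\<lambda>M. vec_index (A M *\<^sub>v X M) i) \<longlonglongrightarrow> vec_index (A' *\<^sub>v x) i"
  unfolding mult_mat_vec_sum[OF A(1) X(1) i] mult_mat_vec_sum[OF A(2) X(2) i]
  by (intro tendsto_sum tendsto_mult lim i) auto

lemma tendsto_det:
  fixes A :: "nat \<Rightarrow> complex mat"
  assumes A: "\<And>M. A M \<in> carrier_mat n n" "A' \<in> carrier_mat n n"
    and lim: "\<And>i j. i < n \<Longrightarrow> j < n \<Longrightarrow> (\<lambda>M. A M $$ (i, j)) \<longlonglongrightarrow> A' $$ (i, j)"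
  shows "(\<lambda>M. Determinant.det (A M)) \<longlonglongrightarrow> Determinant.det A'"
  unfolding det_def'[OF A(1)] det_def'[OF A(2)]
proof (intro tendsto_sum tendsto_mult tendsto_const tendsto_prod)
  fix p i assume "p \<in> {p. p permutes {0..<n}}" "i \<in> {0..<n}"
  then have "i < n" "p i < n" by (auto dest: permutes_in_image[of p _ i])
  then show "(\<lambda>M. A M $$ (i, p i)) \<longlonglongrightarrow> A' $$ (i, p i)" by (rule lim)
qed

lemma tendsto_adj_mat:
  fixes A :: "nat \<Rightarrow> complex mat"
  assumes A: "\<And>M. A M \<in> carrier_mat n n" "A' \<in> carrier_mat n n"
    and lim: "\<And>i j. i < n \<Longrightarrow> j < n \<Longrightarrow> (\<lambda>M. A M $$ (i, j)) \<longlonglongrightarrow> A' $$ (i, j)"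
    and ij: "i < n" "j < n"
  shows "(\<lambda>M. adj_mat (A M) $$ (i, j)) \<longlonglongrightarrow> adj_mat A' $$ (i, j)"
proof -
  have eq: "adj_mat B $$ (i, j) = (-1) ^ (j + i) * Determinant.det (mat_delete B j i)" if "B \<in> carrier_mat n n" for B :: "complex mat"
    using that ij by (simp add: adj_mat_def cofactor_def)
  show ?thesis unfolding eq[OF A(1)] eq[OF A(2)]
  proof (intro tendsto_mult tendsto_const tendsto_det[of _ "n - 1"] mat_delete_carrier A)
    fix k l assume "k < n - 1" "l < n - 1"
    then have kl: "k < n - 1" "l < n - 1" by auto
    have "mat_delete B j i $$ (k, l) = B $$ (if k < j then k else Suc k, if l < i then l else Suc l)"
      if "B \<in> carrier_mat n n" for B :: "complex mat"
      using that kl by (simp add: mat_delete_def)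
    from this[OF A(1)] this[OF A(2)] show "(\<lambda>M. mat_delete (A M) j i $$ (k, l)) \<longlonglongrightarrow> mat_delete A' j i $$ (k, l)"
      using lim kl by simp
  qed
qed

text \<open>The adjugate and the determinant are polynomials in the entries, so this solution
  depends continuously on the system wherever the determinant is nonzero. It is a total function; an
  \<open>M\<close> with zero determinant merely gives a dummy value.\<close>

definition cramer :: "complex mat \<Rightarrow> complex vec \<Rightarrow> complex vec" where
  "cramer G r = (1 / Determinant.det G) \<cdot>\<^sub>v (adj_mat G *\<^sub>v r)"

lemma cramer_carrier [simp]: "G \<in> carrier_mat n n \<Longrightarrow> cramer G r \<in> carrier_vec n"
  using adj_mat(1)[of G n] by (auto simp: cramer_def intro!: carrier_vecI)

lemma mult_cramer:
  assumes G: "G \<in> carrier_mat n n" "Determinant.det G \<noteq> 0" and r: "r \<in> carrier_vec n"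
  shows "G *\<^sub>v cramer G r = r"
proof -
  have "G *\<^sub>v cramer G r = (1 / Determinant.det G) \<cdot>\<^sub>v ((G * adj_mat G) *\<^sub>v r)"
    unfolding cramer_def using adj_mat(1)[OF G(1)] G r
    by (subst mult_mat_vec[OF G(1)]) (auto intro!: mult_mat_vec_carrier)
  also have "(G * adj_mat G) *\<^sub>v r = Determinant.det G \<cdot>\<^sub>v r"
    unfolding adj_mat(2)[OF G(1)] using r by (intro eq_vecI) (auto simp: scalar_prod_left_unit smult_scalar_prod_distrib[of _ n])
  finally show ?thesis using G r by (simp add: smult_smult_assoc)
qed

lemma tendsto_cramer_zero:
  assumes A: "\<And>M. A M \<in> carrier_mat n n" "A' \<in> carrier_mat n n" "Determinant.det A' \<noteq> 0"
    and lim: "\<And>i j. i < n \<Longrightarrow> j < n \<Longrightarrow> (\<lambda>M. A M $$ (i, j)) \<longlonglongrightarrow> A' $$ (i, j)"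
    and X: "\<And>M. X M \<in> carrier_vec n" "\<And>i. i < n \<Longrightarrow> (\<lambda>M. vec_index (X M) i) \<longlonglongrightarrow> 0"
    and i: "i < n"
  shows "(\<lambda>M. vec_index (cramer (A M) (X M)) i) \<longlonglongrightarrow> 0"
proof -
  have eq: "vec_index (cramer (A M) (X M)) i = 1 / Determinant.det (A M) * vec_index (adj_mat (A M) *\<^sub>v X M) i" for M
    using adj_mat(1)[OF A(1), of M] i by (simp add: cramer_def del: index_mult_mat_vec)
  have "(\<lambda>M. vec_index (adj_mat (A M) *\<^sub>v X M) i) \<longlonglongrightarrow> vec_index (adj_mat A' *\<^sub>v 0\<^sub>v n) i"
    by (rule tendsto_mult_mat_vec[where n = n])
      (use adj_mat(1) A X i in \<open>auto intro!: tendsto_adj_mat[of A n] lim\<close>)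
  also have "vec_index (adj_mat A' *\<^sub>v 0\<^sub>v n) i = 0"
    by (subst mult_mat_vec_sum[OF adj_mat(1)[OF A(2)] _ i]) auto
  finally have "(\<lambda>M. 1 / Determinant.det (A M) * vec_index (adj_mat (A M) *\<^sub>v X M) i) \<longlonglongrightarrow> 1 / Determinant.det A' * 0"
    by (intro tendsto_mult tendsto_divide tendsto_const tendsto_det[of A n] A lim)
  then show ?thesis unfolding eq by simp
qed

text \<open>The eigenvectors may vary erratically with \<open>M\<close>, but the length of the
  coordinates is the norm for \<open>G M\<close>, a quantity free of the basis with a convergent
  matrix.\<close>

lemma cvec_norm_eigen_coord_tendsto_zero:
  assumes mp: "\<forall>\<^sub>F M in sequentially. mpEDMD N (G M) (A M) (K M) (lam M) (V M)"
    and A: "\<And>M. A M \<in> carrier_mat N N" and G: "\<And>M. G M \<in> carrier_mat N N" "G' \<in> carrier_mat N N"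
    and lim: "\<And>i j. i < N \<Longrightarrow> j < N \<Longrightarrow> (\<lambda>M. G M $$ (i, j)) \<longlonglongrightarrow> G' $$ (i, j)"
    and f: "\<And>M. f M \<in> carrier_vec N" "\<And>i. i < N \<Longrightarrow> (\<lambda>M. vec_index (f M) i) \<longlonglongrightarrow> 0"
  shows "(\<lambda>M. cvec_norm N (eigen_coord (G M) (V M) (f M))) \<longlonglongrightarrow> 0"
proof -
  have "(\<lambda>M. \<Sum>i<N. vec_index (G M *\<^sub>v f M) i * cnj (vec_index (f M) i)) \<longlonglongrightarrow>
      (\<Sum>i<N. vec_index (G' *\<^sub>v 0\<^sub>v N) i * cnj 0)"
    by (intro tendsto_sum tendsto_mult tendsto_cnj f tendsto_mult_mat_vec[where n = N]) (use G lim f in auto)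
  then have "(\<lambda>M. sqrt (Re (\<Sum>i<N. vec_index (G M *\<^sub>v f M) i * cnj (vec_index (f M) i)))) \<longlonglongrightarrow>
      sqrt (Re (\<Sum>i<N. vec_index (G' *\<^sub>v 0\<^sub>v N) i * cnj 0))"
    by (intro tendsto_real_sqrt tendsto_Re)
  then have lim0: "(\<lambda>M. sqrt (Re ((G M *\<^sub>v f M) \<bullet>c f M))) \<longlonglongrightarrow> 0"
    unfolding cscalar_sum[OF f(1)] by simp
  have "\<forall>\<^sub>F M in sequentially. sqrt (Re ((G M *\<^sub>v f M) \<bullet>c f M)) = cvec_norm N (eigen_coord (G M) (V M) (f M))"
    using mp
  proof eventually_elim
    case (elim M)
    have "(G M *\<^sub>v f M) \<bullet>c f M = of_real ((cvec_norm N (eigen_coord (G M) (V M) (f M)))\<^sup>2)"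
      using mpEDMD_eigen_coord(2)[OF elim A f(1) f(1)] by (simp add: cvec_norm_sq complex_norm_square del: of_real_power)
    then show ?case by (simp del: of_real_power)
  qed
  with lim0 show ?thesis by (rule Lim_transform_eventually)
qed

text \<open>All that is kept of the dynamics: \<open>step\<close> says that the limiting EDMD matrix
  advances the Krylov vectors exactly, and \<open>step_adj\<close> is the isometry of the Koopman
  operator tested against the dictionary. Neither makes the limit an isometry on the whole
  span.\<close>

locale mpEDMD_limit =
  fixes N :: nat and G A K V :: "nat \<Rightarrow> complex mat" and lam :: "nat \<Rightarrow> nat \<Rightarrow> complex"
    and G' A' :: "complex mat" and L :: nat and cs :: "nat \<Rightarrow> complex vec"
  assumes mp: "\<forall>\<^sub>F M in sequentially. mpEDMD N (G M) (A M) (K M) (lam M) (V M)"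
    and G: "\<And>M. G M \<in> carrier_mat N N" "G' \<in> carrier_mat N N"
    and A: "\<And>M. A M \<in> carrier_mat N N" "A' \<in> carrier_mat N N"
    and G_lim: "\<And>i j. i < N \<Longrightarrow> j < N \<Longrightarrow> (\<lambda>M. G M $$ (i, j)) \<longlonglongrightarrow> G' $$ (i, j)"
    and A_lim: "\<And>i j. i < N \<Longrightarrow> j < N \<Longrightarrow> (\<lambda>M. A M $$ (i, j)) \<longlonglongrightarrow> A' $$ (i, j)"
    and det: "Determinant.det G' \<noteq> 0"
    and cs: "\<And>k. cs k \<in> carrier_vec N"
    and step: "\<And>k. k < L \<Longrightarrow> A' *\<^sub>v cs k = G' *\<^sub>v cs (Suc k)"
    and step_adj: "\<And>k. k < L \<Longrightarrow> mat_adjoint A' *\<^sub>v cs (Suc k) = G' *\<^sub>v cs k"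
begin

abbreviation coord :: "nat \<Rightarrow> nat \<Rightarrow> nat \<Rightarrow> complex" where
  "coord M k \<equiv> eigen_coord (G M) (V M) (cs k)"

text \<open>Both defects solve systems with matrix \<open>G M\<close>, and their right-hand sides
  vanish in the limit by \<open>step\<close> and \<open>step_adj\<close> respectively.\<close>

lemma krylov_step:
  assumes k: "k < L"
  shows "(\<lambda>M. cvec_norm N (\<lambda>j. lam M j * coord M k j - coord M (Suc k) j)) \<longlonglongrightarrow> 0"
proof -
  define r where "r M = A M *\<^sub>v cs k - G M *\<^sub>v cs (Suc k)" for M
  define f where "f M = cramer (G M) (r M)" for M
  \<comment> \<open>The adjoint acts on \<open>cs (Suc k) + f M\<close>, the exact EDMD image of
    \<open>cs k\<close> when \<open>G M\<close> is invertible, and not on its limit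
    \<open>cs (Suc k)\<close>.\<close>
  define s where "s M = G M *\<^sub>v cs k - mat_adjoint (A M) *\<^sub>v (cs (Suc k) + f M)" for M
  define q where "q M = cramer (G M) (s M)" for M
  have carr [simp]: "G M *\<^sub>v v \<in> carrier_vec N" "A M *\<^sub>v v \<in> carrier_vec N" "mat_adjoint (A M) *\<^sub>v v \<in> carrier_vec N" for M v
    using G(1)[of M] A(1)[of M] by (auto intro!: carrier_vecI)
  have dimG: "dim_row (G M) = N" "dim_row (A M) = N" "dim_col (A M) = N" for M
    using G(1)[of M] A(1)[of M] by auto
  have f: "f M \<in> carrier_vec N" and q: "q M \<in> carrier_vec N" and r: "r M \<in> carrier_vec N" and s: "s M \<in> carrier_vec N" for M
    by (simp_all add: f_def q_def r_def s_def G(1) cramer_carrier)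
  have r_lim: "(\<lambda>M. vec_index (r M) i) \<longlonglongrightarrow> 0" if i: "i < N" for i
  proof -
    have "(\<lambda>M. vec_index (A M *\<^sub>v cs k) i - vec_index (G M *\<^sub>v cs (Suc k)) i)
        \<longlonglongrightarrow> vec_index (A' *\<^sub>v cs k) i - vec_index (G' *\<^sub>v cs (Suc k)) i"
      by (intro tendsto_diff tendsto_mult_mat_vec[where n = N] A G A_lim G_lim cs tendsto_const i)
    then show ?thesis using i by (simp add: r_def step[OF k] dimG del: index_mult_mat_vec)
  qed
  have f_lim: "(\<lambda>M. vec_index (f M) i) \<longlonglongrightarrow> 0" if "i < N" for i
    unfolding f_def using that by (intro tendsto_cramer_zero[where n = N and A' = G'] G det G_lim r r_lim)
  have s_lim: "(\<lambda>M. vec_index (s M) i) \<longlonglongrightarrow> 0" if i: "i < N" for i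
  proof -
    have "(\<lambda>M. vec_index (cs (Suc k) + f M) j) \<longlonglongrightarrow> vec_index (cs (Suc k)) j" if j: "j < N" for j
      using tendsto_add[OF tendsto_const f_lim[OF j], of "vec_index (cs (Suc k)) j"] f j by (simp add: carrier_vecD[OF f])
    moreover have "(\<lambda>M. mat_adjoint (A M) $$ (i, j)) \<longlonglongrightarrow> mat_adjoint A' $$ (i, j)" if "i < N" "j < N" for i j
      using tendsto_cnj[OF A_lim[OF that(2,1)]] that A(2) by (simp add: dimG)
    ultimately have "(\<lambda>M. vec_index (G M *\<^sub>v cs k) i - vec_index (mat_adjoint (A M) *\<^sub>v (cs (Suc k) + f M)) i)
        \<longlonglongrightarrow> vec_index (G' *\<^sub>v cs k) i - vec_index (mat_adjoint A' *\<^sub>v cs (Suc k)) i"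
      by (intro tendsto_diff tendsto_mult_mat_vec[where n = N] mat_adjoint_carrier A G G_lim cs tendsto_const
          add_carrier_vec f i)
    then show ?thesis using i by (simp add: s_def step_adj[OF k] dimG del: index_mult_mat_vec)
  qed
  have q_lim: "(\<lambda>M. vec_index (q M) i) \<longlonglongrightarrow> 0" if "i < N" for i
    unfolding q_def using that by (intro tendsto_cramer_zero[where n = N and A' = G'] G det G_lim s s_lim)
  have "(\<lambda>M. cvec_norm N (eigen_coord (G M) (V M) (f M)) + cvec_norm N (eigen_coord (G M) (V M) (q M))) \<longlonglongrightarrow> 0 + 0"
    by (intro tendsto_add cvec_norm_eigen_coord_tendsto_zero[OF mp A(1) G G_lim] f q f_lim q_lim)
  then have lim: "(\<lambda>M. cvec_norm N (eigen_coord (G M) (V M) (f M)) + cvec_norm N (eigen_coord (G M) (V M) (q M))) \<longlonglongrightarrow> 0" by simp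
  have "\<forall>\<^sub>F M in sequentially. Determinant.det (G M) \<noteq> 0"
    by (rule tendsto_imp_eventually_ne[OF tendsto_det[OF G G_lim] det])
  with mp have "\<forall>\<^sub>F M in sequentially. norm (cvec_norm N (\<lambda>j. lam M j * coord M k j - coord M (Suc k) j)) \<le>
     cvec_norm N (eigen_coord (G M) (V M) (f M)) + cvec_norm N (eigen_coord (G M) (V M) (q M))"
  proof eventually_elim
    case (elim M)
    have "G M *\<^sub>v f M = A M *\<^sub>v cs k - G M *\<^sub>v cs (Suc k)"
      unfolding f_def using mult_cramer[OF G(1) elim(2) r] by (simp add: r_def)
    moreover have "G M *\<^sub>v q M = G M *\<^sub>v cs k - mat_adjoint (A M) *\<^sub>v (cs (Suc k) + f M)"
      unfolding q_def using mult_cramer[OF G(1) elim(2) s] by (simp add: s_def)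
    ultimately show ?case using mpEDMD_eigen_coord(3)[OF elim(1) A(1) cs cs f q] by simp
  qed
  then show ?thesis by (rule Lim_null_comparison[OF _ lim])
qed

text \<open>The one-step errors telescope; multiplication by unimodular eigenvalues leaves earlier
  errors at their size.\<close>

lemma krylov_power:
  "k \<le> L \<Longrightarrow> (\<lambda>M. cvec_norm N (\<lambda>j. lam M j ^ k * coord M 0 j - coord M k j)) \<longlonglongrightarrow> 0"
proof (induction k)
  case 0
  then show ?case by (simp add: cvec_norm_def L2_set_def)
next
  case (Suc k)
  have lim: "(\<lambda>M. cvec_norm N (\<lambda>j. lam M j ^ k * coord M 0 j - coord M k j) +
      cvec_norm N (\<lambda>j. lam M j * coord M k j - coord M (Suc k) j)) \<longlonglongrightarrow> 0"
    using tendsto_add[OF Suc.IH krylov_step[of k]] Suc.prems by simp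
  have "\<forall>\<^sub>F M in sequentially. norm (cvec_norm N (\<lambda>j. lam M j ^ Suc k * coord M 0 j - coord M (Suc k) j)) \<le>
     cvec_norm N (\<lambda>j. lam M j ^ k * coord M 0 j - coord M k j) + cvec_norm N (\<lambda>j. lam M j * coord M k j - coord M (Suc k) j)"
    using mp
  proof eventually_elim
    case (elim M)
    have "cvec_norm N (\<lambda>j. lam M j ^ Suc k * coord M 0 j - coord M (Suc k) j) =
        cvec_norm N (\<lambda>j. lam M j * (lam M j ^ k * coord M 0 j - coord M k j) + (lam M j * coord M k j - coord M (Suc k) j))"
      by (simp add: algebra_simps)
    also have "\<dots> \<le> cvec_norm N (\<lambda>j. lam M j * (lam M j ^ k * coord M 0 j - coord M k j)) +
        cvec_norm N (\<lambda>j. lam M j * coord M k j - coord M (Suc k) j)" by (rule cvec_norm_triangle)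
    also have "cvec_norm N (\<lambda>j. lam M j * (lam M j ^ k * coord M 0 j - coord M k j)) =
        cvec_norm N (\<lambda>j. lam M j ^ k * coord M 0 j - coord M k j)"
      by (rule cvec_norm_cong) (simp add: norm_mult mpEDMD_eigen_coord(1)[OF elim A(1)])
    finally show ?case by simp
  qed
  then show ?case by (rule Lim_null_comparison[OF _ lim])
qed

lemma coord_inner:
  "(\<lambda>M. \<Sum>n<N. coord M i n * cnj (coord M j n)) \<longlonglongrightarrow> (G' *\<^sub>v cs i) \<bullet>c cs j"
proof -
  have "(\<lambda>M. \<Sum>n<N. vec_index (G M *\<^sub>v cs i) n * cnj (vec_index (cs j) n))
      \<longlonglongrightarrow> (\<Sum>n<N. vec_index (G' *\<^sub>v cs i) n * cnj (vec_index (cs j) n))"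
    by (intro tendsto_sum tendsto_mult tendsto_const tendsto_mult_mat_vec[where n = N] G G_lim cs) auto
  then have "(\<lambda>M. (G M *\<^sub>v cs i) \<bullet>c cs j) \<longlonglongrightarrow> (G' *\<^sub>v cs i) \<bullet>c cs j"
    by (simp only: cscalar_sum[OF cs])
  then show ?thesis
    by (rule Lim_transform_eventually)
      (use mp in eventually_elim, simp add: mpEDMD_eigen_coord(2)[OF _ A(1) cs cs])
qed

text \<open>Each summand is \<open>lam^i * coord 0\<close> times the conjugate of
  \<open>lam^j * coord 0\<close>. Both factors are Krylov coordinates up to an error
  \<open>e\<close>; the three products containing \<open>e\<close> vanish by Cauchy-Schwarz.\<close>

lemma krylov_moments:
  assumes i: "i \<le> L" and j: "j \<le> L"
  shows "(\<lambda>M. \<Sum>n<N. of_real ((cmod (coord M 0 n))\<^sup>2) * (lam M n ^ i * cnj (lam M n) ^ j))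
    \<longlonglongrightarrow> (G' *\<^sub>v cs i) \<bullet>c cs j"
proof -
  define e where "e M k n = lam M n ^ k * coord M 0 n - coord M k n" for M k n
  have e: "(\<lambda>M. cvec_norm N (e M k)) \<longlonglongrightarrow> 0" if "k \<le> L" for k
    unfolding e_def using krylov_power[OF that] .
  have bounded: "(\<lambda>M. cvec_norm N (coord M k)) \<longlonglongrightarrow> sqrt (Re ((G' *\<^sub>v cs k) \<bullet>c cs k))" for k
  proof -
    have "(\<lambda>M. sqrt (Re (\<Sum>n<N. coord M k n * cnj (coord M k n)))) \<longlonglongrightarrow> sqrt (Re ((G' *\<^sub>v cs k) \<bullet>c cs k))"
      by (intro tendsto_intros coord_inner)
    moreover have "sqrt (Re (\<Sum>n<N. coord M k n * cnj (coord M k n))) = cvec_norm N (coord M k)" for M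
      by (simp add: cvec_norm_def L2_set_def flip: complex_norm_square of_real_power)
    ultimately show ?thesis by simp
  qed
  have prod0: "(\<lambda>M. \<Sum>n<N. u M n * cnj (v M n)) \<longlonglongrightarrow> 0"
    if "(\<lambda>M. cvec_norm N (u M) * cvec_norm N (v M)) \<longlonglongrightarrow> 0" for u v
    by (rule Lim_null_comparison[OF always_eventually that]) (simp add: cvec_norm_inner)
  have "(\<lambda>M. (\<Sum>n<N. coord M i n * cnj (coord M j n)) + (\<Sum>n<N. e M i n * cnj (coord M j n))
     + (\<Sum>n<N. coord M i n * cnj (e M j n)) + (\<Sum>n<N. e M i n * cnj (e M j n)))
     \<longlonglongrightarrow> (G' *\<^sub>v cs i) \<bullet>c cs j + 0 + 0 + 0"
    using tendsto_mult[OF e[OF i] bounded[of j]] tendsto_mult[OF bounded[of i] e[OF j]]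
      tendsto_mult[OF e[OF i] e[OF j]]
    by (intro tendsto_add coord_inner prod0) simp_all
  moreover have "(\<Sum>n<N. coord M i n * cnj (coord M j n)) + (\<Sum>n<N. e M i n * cnj (coord M j n))
     + (\<Sum>n<N. coord M i n * cnj (e M j n)) + (\<Sum>n<N. e M i n * cnj (e M j n))
     = (\<Sum>n<N. of_real ((cmod (coord M 0 n))\<^sup>2) * (lam M n ^ i * cnj (lam M n) ^ j))" for M
    unfolding sum.distrib[symmetric] complex_norm_square
    by (rule sum.cong[OF refl]) (simp add: e_def algebra_simps)
  ultimately show ?thesis by simp
qed

end

section \<open>Transfer to the Koopman operator and choice of the constant\<close>

lemma G_mat_carrier: "G_mat N \<psi> M x w \<in> carrier_mat N N"
  and A_mat_carrier: "A_mat N \<psi> F M x w \<in> carrier_mat N N"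
  by (auto simp: G_mat_def A_mat_def psi_mat_def intro!: carrier_matI)

lemma limsup_W1_le:
  fixes L :: nat
  assumes mps: "measure_preserving_system d \<omega> F" and E: "koopman_spectral_measure \<omega> F E"
    and dict: "dictionary \<omega> N \<psi>"
    and G: "\<And>M. G M \<in> carrier_mat N N" and A: "\<And>M. A M \<in> carrier_mat N N"
    and mp: "\<forall>\<^sub>F M in sequentially. mpEDMD N (G M) (A M) (K M) (lam M) (V M)"
    and g: "g \<in> L2 \<omega>" and norm: "l2_inner \<omega> g g = 1"
    and krylov: "\<And>k. k \<le> L \<Longrightarrow> (koopman F ^^ k) g \<in> dict_span \<omega> N \<psi>"
    and c: "c \<in> carrier_vec N" "AE z in \<omega>. g z = synth N \<psi> c z"
    and G_lim: "\<And>j k. j < N \<Longrightarrow> k < N \<Longrightarrow> (\<lambda>M. G M $$ (j, k)) \<longlonglongrightarrow> l2_inner \<omega> (\<psi> k) (\<psi> j)"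
    and A_lim: "\<And>j k. j < N \<Longrightarrow> k < N \<Longrightarrow> (\<lambda>M. A M $$ (j, k)) \<longlonglongrightarrow> l2_inner \<omega> (koopman F (\<psi> k)) (\<psi> j)"
  shows "limsup (\<lambda>M. W1 (scalar_spectral_measure \<omega> E g)
                   (mpEDMD_measure N (G M) (lam M) (V M) (normalize_coeffs (G M) c)))
      \<le> ereal (2 * sqrt 10 / real (L + 2))"
proof -
  define \<mu> where "\<mu> = scalar_spectral_measure \<omega> E g"
  define \<nu> where "\<nu> M = mpEDMD_measure N (G M) (lam M) (V M) (normalize_coeffs (G M) c)" for M
  define Kg where "Kg k = (koopman F ^^ k) g" for k
  have \<mu>: "circle_prob \<mu>" "moment \<mu> i j = l2_inner \<omega> (Kg i) (Kg j)" for i j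
  proof -
    from E obtain scale :: "complex \<Rightarrow> observable \<Rightarrow> observable" and H ip J K' E'
      where ext: "koopman_unitary_extension scale H ip \<omega> F J K' E'"
      and comp: "koopman_unitary_extension.compression ip \<omega> J E' E"
      unfolding koopman_spectral_measure_def by blast
    interpret koopman_unitary_extension scale H ip \<omega> F J K' E' by (rule ext)
    show "circle_prob \<mu>" unfolding \<mu>_def by (rule circle_prob_scalar_spectral_measure[OF comp g norm])
    show "moment \<mu> i j = l2_inner \<omega> (Kg i) (Kg j)"
      unfolding \<mu>_def Kg_def by (rule moment_scalar_spectral_measure[OF mps comp g])
  qed
  have \<psi>: "\<psi> j \<in> L2 \<omega>" if "j < N" for j using dict that by (simp add: dictionary_def)
  have K\<psi>: "koopman F (\<psi> j) \<in> L2 \<omega>" if "j < N" for j using koopman_L2[OF mps \<psi>[OF that]] .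
  have Kg: "Kg k \<in> L2 \<omega>" for k unfolding Kg_def by (rule koopman_pow_L2[OF mps g])
  have Kg_Suc: "Kg (Suc k) = koopman F (Kg k)" for k by (simp add: Kg_def)
  \<comment> \<open>Index 0 must receive \<open>c\<close> itself, from which the mpEDMD measure is
    formed. Indices above \<open>L\<close> receive \<open>c\<close> as a filler.\<close>
  have "\<exists>cs. \<forall>k. cs k \<in> carrier_vec N \<and> (k \<le> L \<longrightarrow> (AE z in \<omega>. Kg k z = synth N \<psi> (cs k) z)) \<and> (k = 0 \<longrightarrow> cs k = c)"
  proof (intro choice allI)
    fix k
    show "\<exists>v. v \<in> carrier_vec N \<and> (k \<le> L \<longrightarrow> (AE z in \<omega>. Kg k z = synth N \<psi> v z)) \<and> (k = 0 \<longrightarrow> v = c)"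
    proof (cases "k = 0 \<or> L < k")
      case True
      then show ?thesis using c by (intro exI[of _ c]) (auto simp: Kg_def)
    next
      case False
      then show ?thesis using krylov[of k] by (auto simp: dict_span_def Kg_def)
    qed
  qed
  then obtain cs where cs: "\<And>k. cs k \<in> carrier_vec N" and cs_AE: "\<And>k. k \<le> L \<Longrightarrow> AE z in \<omega>. Kg k z = synth N \<psi> (cs k) z"
    and cs0: "cs 0 = c" by metis
  have synth: "synth N \<psi> v \<in> L2 \<omega>" for v by (rule L2_synth) (rule \<psi>)
  define G' where "G' = gram_mat \<omega> N \<psi> \<psi>"
  define A' where "A' = gram_mat \<omega> N (\<lambda>j. koopman F (\<psi> j)) \<psi>"
  have carr: "G' \<in> carrier_mat N N" "A' \<in> carrier_mat N N" by (simp_all add: G'_def A'_def)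
  have G'cs: "vec_index (G' *\<^sub>v cs k) j = l2_inner \<omega> (Kg k) (\<psi> j)" if "k \<le> L" "j < N" for j k
  proof -
    have "vec_index (G' *\<^sub>v cs k) j = l2_inner \<omega> (synth N \<psi> (cs k)) (\<psi> j)"
      unfolding G'_def by (rule gram_mat_mult_vec) (use \<psi> cs that in auto)
    also have "\<dots> = l2_inner \<omega> (Kg k) (\<psi> j)"
      by (rule l2_inner_cong_AE) (use synth Kg \<psi> that cs_AE[OF that(1)] in auto)
    finally show ?thesis .
  qed
  interpret lim: mpEDMD_limit N G A K V lam G' A' L cs
  proof
    show "\<forall>\<^sub>F M in sequentially. mpEDMD N (G M) (A M) (K M) (lam M) (V M)" by (rule mp)
    show "Determinant.det G' \<noteq> 0" unfolding G'_def by (rule det_gram_mat[OF dict])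
    show "(\<lambda>M. G M $$ (i, j)) \<longlonglongrightarrow> G' $$ (i, j)" "(\<lambda>M. A M $$ (i, j)) \<longlonglongrightarrow> A' $$ (i, j)"
      if "i < N" "j < N" for i j using G_lim[OF that] A_lim[OF that] that by (simp_all add: G'_def A'_def gram_mat_def)
    fix k assume k: "k < L"
    have dims: "dim_row G' = N" "dim_row A' = N" "dim_col A' = N" using carr by auto
    show "A' *\<^sub>v cs k = G' *\<^sub>v cs (Suc k)"
    proof (rule eq_vecI)
      fix j assume "j < dim_vec (G' *\<^sub>v cs (Suc k))"
      then have j: "j < N" by (simp add: dims)
      have "vec_index (A' *\<^sub>v cs k) j = l2_inner \<omega> (koopman F (synth N \<psi> (cs k))) (\<psi> j)"
        unfolding A'_def koopman_synth[OF mps] by (rule gram_mat_mult_vec) (use K\<psi> \<psi> cs j in auto)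
      also have "\<dots> = l2_inner \<omega> (Kg (Suc k)) (\<psi> j)"
        unfolding Kg_Suc
        by (rule l2_inner_cong_AE[symmetric])
          (use koopman_L2[OF mps] synth Kg \<psi> j koopman_cong_AE[OF mps cs_AE[of k]] k in auto)
      finally show "vec_index (A' *\<^sub>v cs k) j = vec_index (G' *\<^sub>v cs (Suc k)) j" using k j by (simp only: G'cs Suc_leI)
    qed (simp add: dims)
    show "mat_adjoint A' *\<^sub>v cs (Suc k) = G' *\<^sub>v cs k"
    proof (rule eq_vecI)
      fix j assume "j < dim_vec (G' *\<^sub>v cs k)"
      then have j: "j < N" by (simp add: dims)
      have "vec_index (mat_adjoint A' *\<^sub>v cs (Suc k)) j = l2_inner \<omega> (synth N \<psi> (cs (Suc k))) (koopman F (\<psi> j))"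
        unfolding A'_def gram_mat_adjoint by (rule gram_mat_mult_vec) (use K\<psi> \<psi> cs j in auto)
      also have "\<dots> = l2_inner \<omega> (Kg (Suc k)) (koopman F (\<psi> j))"
        by (rule l2_inner_cong_AE[symmetric]) (use K\<psi> synth Kg j cs_AE[of "Suc k"] k in auto)
      also have "\<dots> = l2_inner \<omega> (Kg k) (\<psi> j)"
        unfolding Kg_Suc by (rule koopman_isometry[OF mps Kg \<psi>[OF j]])
      finally show "vec_index (mat_adjoint A' *\<^sub>v cs (Suc k)) j = vec_index (G' *\<^sub>v cs k) j"
        using k j by (simp only: G'cs less_imp_le)
    qed (simp add: dims)
  qed (use G A carr cs in auto)
  have inner: "(G' *\<^sub>v cs i) \<bullet>c cs j = moment \<mu> i j" if "i \<le> L" "j \<le> L" for i j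
  proof -
    have "(G' *\<^sub>v cs i) \<bullet>c cs j = l2_inner \<omega> (synth N \<psi> (cs i)) (synth N \<psi> (cs j))"
      unfolding G'_def by (rule gram_mat_cscalar) (use \<psi> cs in auto)
    also have "\<dots> = l2_inner \<omega> (Kg i) (Kg j)"
      by (rule l2_inner_cong_AE[symmetric]) (use synth Kg cs_AE that in auto)
    finally show ?thesis by (simp add: \<mu>(2))
  qed
  define \<rho> where "\<rho> M = Re ((G M *\<^sub>v c) \<bullet>c c)" for M
  \<comment> \<open>The squared norm of \<open>c\<close> for \<open>G M\<close> tends to that of
    \<open>g\<close>. This gives positivity for large \<open>M\<close> and makes the normalization
    disappear in the limit.\<close>
  have \<rho>: "\<rho> \<longlonglongrightarrow> 1"
  proof -
    have "(\<lambda>M. (\<Sum>n<N. lim.coord M 0 n * cnj (lim.coord M 0 n))) \<longlonglongrightarrow> 1"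
      using lim.coord_inner[of 0 0] by (simp add: inner \<mu>(2) norm Kg_def)
    moreover have "\<forall>\<^sub>F M in sequentially. Re (\<Sum>n<N. lim.coord M 0 n * cnj (lim.coord M 0 n)) = \<rho> M"
      using mp
    proof eventually_elim
      case (elim M)
      show ?case by (simp only: mpEDMD_eigen_coord(2)[OF elim A c(1) c(1)] cs0 \<rho>_def)
    qed
    ultimately show ?thesis using Lim_transform_eventually[OF tendsto_Re] by fastforce
  qed
  then have pos: "\<forall>\<^sub>F M in sequentially. 0 < \<rho> M" by (rule order_tendstoD) simp
  have moments: "(\<lambda>M. moment (\<nu> M) i j) \<longlonglongrightarrow> moment \<mu> i j" if "i \<le> L" "j \<le> L" for i j
  proof -
    have "(\<lambda>M. (\<Sum>n<N. of_real ((cmod (lim.coord M 0 n))\<^sup>2) * (lam M n ^ i * cnj (lam M n) ^ j)) / of_real (\<rho> M))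
      \<longlonglongrightarrow> moment \<mu> i j / of_real 1"
      unfolding inner[OF that, symmetric]
      by (intro tendsto_divide lim.krylov_moments that tendsto_of_real \<rho>) simp
    moreover have "\<forall>\<^sub>F M in sequentially.
      (\<Sum>n<N. of_real ((cmod (lim.coord M 0 n))\<^sup>2) * (lam M n ^ i * cnj (lam M n) ^ j)) / of_real (\<rho> M) = moment (\<nu> M) i j"
      using mp pos
    proof eventually_elim
      case (elim M)
      show ?case
        using mpEDMD_measure_moment(2)[OF elim(1) A G c(1)] elim(2) by (simp only: \<nu>_def \<rho>_def cs0)
    qed
    ultimately show ?thesis by (simp add: Lim_transform_eventually)
  qed
  \<comment> \<open>With \<open>L\<close> fixed, finitely many moment differences occur and all tend
    to zero; only the smoothing error of the two measures is left.\<close>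
  define b where "b M = 2 * sqrt 10 / real (L + 2) +
    (\<Sum>i<Suc L. \<Sum>j<Suc L. 2 / kernel_mass (L + 2) * \<bar>parabola (L + 2) (Suc i) * parabola (L + 2) (Suc j)\<bar>
       * cmod (moment \<mu> i j - moment (\<nu> M) i j))" for M
  have "b \<longlonglongrightarrow> 2 * sqrt 10 / real (L + 2) +
    (\<Sum>i<Suc L. \<Sum>j<Suc L. 2 / kernel_mass (L + 2) * \<bar>parabola (L + 2) (Suc i) * parabola (L + 2) (Suc j)\<bar>
       * cmod (moment \<mu> i j - moment \<mu> i j))"
    unfolding b_def
    by (intro tendsto_add tendsto_const tendsto_sum tendsto_mult tendsto_norm tendsto_diff moments) auto
  then have b: "(\<lambda>M. ereal (b M)) \<longlonglongrightarrow> ereal (2 * sqrt 10 / real (L + 2))" by simp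
  have "\<forall>\<^sub>F M in sequentially. W1 \<mu> (\<nu> M) \<le> ereal (b M)"
    using mp pos
  proof eventually_elim
    case (elim M)
    have "circle_prob (\<nu> M)"
      unfolding \<nu>_def by (rule mpEDMD_measure_moment(1)[OF elim(1) A G c(1)]) (use elim(2) in \<open>simp add: \<rho>_def\<close>)
    then show ?case unfolding b_def by (rule W1_le_moments[OF \<mu>(1)])
  qed
  then have "limsup (\<lambda>M. W1 \<mu> (\<nu> M)) \<le> limsup (\<lambda>M. ereal (b M))" by (rule Limsup_mono)
  also have "\<dots> = ereal (2 * sqrt 10 / real (L + 2))" by (rule lim_imp_Limsup[OF _ b]) simp
  finally show ?thesis by (simp add: \<mu>_def \<nu>_def)
qed

theorem corollary5p7:
  shows "\<exists>C>0. \<forall>(d::nat) (\<omega> :: point measure) (F :: point \<Rightarrow> point)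
      (E :: complex set \<Rightarrow> observable \<Rightarrow> observable)
      (N::nat) (\<psi> :: nat \<Rightarrow> observable)
      (x :: nat \<Rightarrow> nat \<Rightarrow> point) (w :: nat \<Rightarrow> nat \<Rightarrow> real)
      (G :: nat \<Rightarrow> complex mat) (A :: nat \<Rightarrow> complex mat)
      (K :: nat \<Rightarrow> complex mat) (lam :: nat \<Rightarrow> nat \<Rightarrow> complex) (V :: nat \<Rightarrow> complex mat)
      (L::nat) (g :: observable) (c :: complex vec).
    measure_preserving_system d \<omega> F \<longrightarrow>
    koopman_spectral_measure \<omega> F E \<longrightarrow>
    dictionary \<omega> N \<psi> \<longrightarrow>
    (\<forall>M. \<forall>m<M. x M m \<in> space \<omega> \<and> 0 \<le> w M m) \<longrightarrow>
    (\<forall>M. G M = G_mat N \<psi> M (x M) (w M)) \<longrightarrow>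
    (\<forall>M. A M = A_mat N \<psi> F M (x M) (w M)) \<longrightarrow>
    (\<forall>\<^sub>F M in sequentially. mpEDMD N (G M) (A M) (K M) (lam M) (V M)) \<longrightarrow>
    2 \<le> L \<longrightarrow>
    g \<in> L2 \<omega> \<longrightarrow> l2_inner \<omega> g g = 1 \<longrightarrow>
    (\<forall>k\<le>L. (koopman F ^^ k) g \<in> dict_span \<omega> N \<psi>) \<longrightarrow>
    c \<in> carrier_vec N \<longrightarrow> (AE z in \<omega>. g z = synth N \<psi> c z) \<longrightarrow>
    (\<forall>j<N. \<forall>k<N. (\<lambda>M. G M $$ (j, k)) \<longlonglongrightarrow> l2_inner \<omega> (\<psi> k) (\<psi> j)) \<longrightarrow>
    (\<forall>j<N. \<forall>k<N. (\<lambda>M. A M $$ (j, k)) \<longlonglongrightarrow> l2_inner \<omega> (koopman F (\<psi> k)) (\<psi> j)) \<longrightarrow>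
    limsup (\<lambda>M. W1 (scalar_spectral_measure \<omega> E g)
                   (mpEDMD_measure N (G M) (lam M) (V M) (normalize_coeffs (G M) c)))
      \<le> ereal (C * ln (real L) / real L)"
\<comment> \<open>The bound \<open>2 * sqrt 10 / (L + 2)\<close> is weakened to the logarithmic form
  by \<open>ln 2 \<le> ln L\<close>; this accounts for the divisor \<open>ln 2\<close>.\<close>
proof (intro exI[of _ "2 * sqrt 10 / ln 2"] conjI allI impI, goal_cases)
  case 1
  then show ?case by simp
next
  case (2 d \<omega> F E N \<psi> x w G A K lam V L g c)
  have "limsup (\<lambda>M. W1 (scalar_spectral_measure \<omega> E g)
      (mpEDMD_measure N (G M) (lam M) (V M) (normalize_coeffs (G M) c))) \<le> ereal (2 * sqrt 10 / real (L + 2))"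
    by (rule limsup_W1_le[where d = d and F = F and \<psi> = \<psi> and A = A and K = K])
      (use 2 G_mat_carrier A_mat_carrier in \<open>simp_all only: simp_thms\<close>)
  also have "2 * sqrt 10 / real (L + 2) \<le> 2 * sqrt 10 / ln 2 * ln (real L) / real L"
  proof -
    have "2 * sqrt 10 / real (L + 2) \<le> 2 * sqrt 10 / real L" using 2 by (intro divide_left_mono) auto
    also have "\<dots> = 2 * sqrt 10 / ln 2 * ln 2 / real L" by simp
    also have "\<dots> \<le> 2 * sqrt 10 / ln 2 * ln (real L) / real L"
      using 2 by (intro divide_right_mono mult_left_mono) auto
    finally show ?thesis .
  qed
  finally show ?case by simp
qed

end
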